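(* Let $A$ be a partial isometry acting on a $5$-dimensional complex Hilbert space, and assume that its numerical range $W(A)$ is a circular disk. Then this disk is centered at the origin.
   Context: For a bounded linear operator $A$ on a complex Hilbert space $\mathcal H$, the numerical range of $A$ is $W(A)=\{\langle Ax,x\rangle : x\in\mathcal H,\ \|x\|=1\}\subset\mathbb C$. The operator $A$ is a partial isometry if $\|Ax\|=\|x\|$ for all $x\in\ker(A)^\perp$. A circular disk is a set $\{z\in\mathbb C: |z-c|\le r\}$ with center $c\in\mathbb C$ and positive radius $r>0$ (a single point is not regarded as a circular disk). *)

theory Defs
  imports "HOL-Analysis.Analysis"
begin

text \<open>
  Complex Hilbert spaces. The superclass \<open>banach\<close> supplies completeness with respect to the norm,
  and the last two axioms tie the norm and the real scalar multiplication to the complex structure.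
  The inner product is linear in its first argument and conjugate-linear in its second.
\<close>

class complex_hilbert_space = banach +
  fixes scaleC :: "complex \<Rightarrow> 'a \<Rightarrow> 'a" (infixr "*\<^sub>C" 75)
    and cinner :: "'a \<Rightarrow> 'a \<Rightarrow> complex"
  assumes scaleC_add_right: "a *\<^sub>C (x + y) = a *\<^sub>C x + a *\<^sub>C y"
    and scaleC_add_left: "(a + b) *\<^sub>C x = a *\<^sub>C x + b *\<^sub>C x"
    and scaleC_scaleC: "a *\<^sub>C b *\<^sub>C x = (a * b) *\<^sub>C x"
    and scaleC_one: "1 *\<^sub>C x = x"
    and cinner_add_left: "cinner (x + y) z = cinner x z + cinner y z"
    and cinner_scaleC_left: "cinner (a *\<^sub>C x) y = a * cinner x y"
    and cinner_commute: "cinner x y = cnj (cinner y x)"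
    and cinner_ge_zero: "0 \<le> Re (cinner x x)"
    and cinner_eq_zero_iff: "cinner x x = 0 \<longleftrightarrow> x = 0"
    and scaleR_scaleC: "r *\<^sub>R x = of_real r *\<^sub>C x"
    and norm_eq_sqrt_cinner: "norm x = sqrt (Re (cinner x x))"

global_interpretation complex_vector:
  vector_space "scaleC :: complex \<Rightarrow> 'a \<Rightarrow> 'a::complex_hilbert_space"
  by unfold_locales
    (simp_all add: scaleC_add_right scaleC_add_left scaleC_scaleC scaleC_one)

definition bounded_clinear :: "('a::complex_hilbert_space \<Rightarrow> 'a) \<Rightarrow> bool" where
  "bounded_clinear A \<longleftrightarrow>
     Vector_Spaces.linear scaleC scaleC A \<and> (\<exists>K. \<forall>x. norm (A x) \<le> K * norm x)"

definition numerical_range :: "('a::complex_hilbert_space \<Rightarrow> 'a) \<Rightarrow> complex set" where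
  "numerical_range A = {cinner (A x) x | x. norm x = 1}"

definition kernel :: "('a::complex_hilbert_space \<Rightarrow> 'a) \<Rightarrow> 'a set" where
  "kernel A = {x. A x = 0}"

definition orthogonal_complement :: "'a::complex_hilbert_space set \<Rightarrow> 'a set" where
  "orthogonal_complement S = {x. \<forall>y\<in>S. cinner x y = 0}"

definition partial_isometry :: "('a::complex_hilbert_space \<Rightarrow> 'a) \<Rightarrow> bool" where
  "partial_isometry A \<longleftrightarrow>
     bounded_clinear A \<and> (\<forall>x\<in>orthogonal_complement (kernel A). norm (A x) = norm x)"

end

theory Submission
  imports Defs "HOL-Computational_Algebra.Fundamental_Theorem_Algebra"
begin

text \<open>
  Suppose \<open>c \<noteq> 0\<close>. Let \<open>C\<close> be the compression of \<open>A\<close> to \<open>E = (ker A)\<^sup>\<bottom>\<close>, in triangular form. Every tangent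
  of the circle makes \<open>t\<^sup>2 A + A\<^sup>* + w\<close> singular, where \<open>|t| = 1\<close> and \<open>w = 2 r t - c t\<^sup>2 - c\<^sup>*\<close>.
  Eliminating the kernel with \<open>A\<^sup>* A = 1\<close> on \<open>E\<close> makes \<open>(w + C\<^sup>*) (w + t\<^sup>2 C) - t\<^sup>2\<close> singular. Its
  determinant is a polynomial in \<open>t\<close>, so it vanishes identically and can be studied as \<open>t \<rightarrow> 0\<close>.
  Up to a scalar and an invertible factor the matrix is \<open>C\<^sup>* - c\<^sup>* + 2 r t + O(t\<^sup>2)\<close>, with a scalar
  perturbation up to order three. If \<open>c\<close> had multiplicity at most three as an eigenvalue of \<open>C\<close>, the
  determinant would have a nonzero term of that order. Hence \<open>dim E = 4\<close>, all eigenvalues of \<open>C\<close>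
  equal \<open>c\<close>, and the term of order four relates \<open>r\<close> to the entries of \<open>C\<close>. Since \<open>1 - C\<^sup>* C\<close> has rank
  one, these entries are known up to phases; they then contradict the fact that compressions of
  \<open>A - c\<close> have numerical radius at most \<open>r\<close>.
\<close>

section \<open>Finite-dimensional complex inner product spaces\<close>

lemma cinner_scaleC_right: "cinner x (a *\<^sub>C y) = cnj a * cinner x y"
  by (metis cinner_commute cinner_scaleC_left complex_cnj_mult)

lemma cinner_add_right: "cinner x (y + z) = cinner x y + cinner x z"
  by (metis cinner_commute cinner_add_left complex_cnj_add)

lemma cinner_zero_left [simp]: "cinner 0 x = 0"
  using cinner_add_left[of 0 0 x] by simp

lemma cinner_zero_right [simp]: "cinner x 0 = 0"
  using cinner_add_right[of x 0 0] by simp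

lemma cinner_diff_left: "cinner (x - y) z = cinner x z - cinner y z"
  using cinner_add_left[of "x - y" y z] by simp

lemma cinner_diff_right: "cinner x (y - z) = cinner x y - cinner x z"
  using cinner_add_right[of x "y - z" z] by simp

lemma cinner_sum_left: "cinner (\<Sum>i\<in>I. f i) y = (\<Sum>i\<in>I. cinner (f i) y)"
  by (induction I rule: infinite_finite_induct) (simp_all add: cinner_add_left)

lemma cinner_sum_right: "cinner y (\<Sum>i\<in>I. f i) = (\<Sum>i\<in>I. cinner y (f i))"
  by (induction I rule: infinite_finite_induct) (simp_all add: cinner_add_right)

lemmas cinner_simps = cinner_add_left cinner_add_right cinner_diff_left cinner_diff_right
  cinner_scaleC_left cinner_scaleC_right

lemma cinner_self: "cinner x x = of_real ((norm x)\<^sup>2)"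
proof -
  have "Im (cinner x x) = 0"
    using arg_cong[OF cinner_commute[of x x], of Im] by simp
  moreover have "Re (cinner x x) = (norm x)\<^sup>2"
    using cinner_ge_zero[of x] by (simp add: norm_eq_sqrt_cinner)
  ultimately show ?thesis by (simp add: complex_eq_iff)
qed

lemma norm_scaleC: "norm (a *\<^sub>C x) = cmod a * norm x"
proof -
  have "complex_of_real ((norm (a *\<^sub>C x))\<^sup>2) = of_real ((cmod a * norm x)\<^sup>2)"
    unfolding cinner_self[symmetric] cinner_scaleC_left cinner_scaleC_right
    unfolding cinner_self power_mult_distrib of_real_mult complex_norm_square by (simp add: mult_ac)
  then have "(norm (a *\<^sub>C x))\<^sup>2 = (cmod a * norm x)\<^sup>2"
    by (simp only: of_real_eq_iff)
  then show ?thesis by simp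
qed

lemma cinner_eq_0_commute: "cinner x y = 0 \<longleftrightarrow> cinner y x = 0"
  by (metis cinner_commute complex_cnj_zero)

lemma ex_unit_multiple:
  fixes x :: "'a::complex_hilbert_space"
  assumes "x \<noteq> 0"
  obtains k where "cinner (k *\<^sub>C x) (k *\<^sub>C x) = 1"
proof
  show "cinner ((1 / of_real (norm x)) *\<^sub>C x) ((1 / of_real (norm x)) *\<^sub>C x) = 1"
    using assms unfolding cinner_scaleC_left cinner_scaleC_right cinner_self[of x]
    by (simp add: power2_eq_square)
qed

section \<open>Orthonormal sets, projections and eigenvectors\<close>

definition orthonormal :: "'a::complex_hilbert_space set \<Rightarrow> bool" where
  "orthonormal B \<longleftrightarrow> (\<forall>x\<in>B. \<forall>y\<in>B. cinner x y = (if x = y then 1 else 0))"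

lemma orthonormal_insert:
  assumes "orthonormal B" "cinner x x = 1" "\<forall>b\<in>B. cinner x b = 0"
  shows "orthonormal (insert x B)" "x \<notin> B"
  using assms cinner_eq_0_commute unfolding orthonormal_def by fastforce+

lemma orthonormal_coeff:
  assumes "orthonormal B" "finite B" "b \<in> B"
  shows "cinner (\<Sum>v\<in>B. u v *\<^sub>C v) b = u b"
proof -
  have "cinner (\<Sum>v\<in>B. u v *\<^sub>C v) b = (\<Sum>v\<in>B. if v = b then u v else 0)"
    unfolding cinner_sum_left cinner_scaleC_left
    using assms by (intro sum.cong) (auto simp: orthonormal_def)
  also have "\<dots> = u b" using assms by simp
  finally show ?thesis .
qed

lemma orthonormal_independent:
  assumes "orthonormal B"
  shows "complex_vector.independent B"
proof
  assume "complex_vector.dependent B"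
  then obtain t u v where *: "finite t" "t \<subseteq> B" "(\<Sum>v\<in>t. u v *\<^sub>C v) = 0" "v \<in> t" "u v \<noteq> 0"
    unfolding complex_vector.dependent_explicit by auto
  have "orthonormal t" using assms * unfolding orthonormal_def by blast
  from orthonormal_coeff[OF this *(1) *(4), of u] * show False by simp
qed

text \<open>\<open>dim\<close> is the \<open>card\<close> of a basis, and \<open>card\<close> is 0
  on infinite sets. The hypothesis \<open>dim > 0\<close> is thus how finite dimension is expressed
  throughout.\<close>

lemma independent_card_le_dim:
  fixes B :: "'a::complex_hilbert_space set"
  assumes "complex_vector.dim (UNIV :: 'a set) > 0" "complex_vector.independent B"
  shows "finite B \<and> card B \<le> complex_vector.dim (UNIV :: 'a set)"
proof -
  obtain T :: "'a set" where T: "UNIV \<subseteq> complex_vector.span T"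
    "card T = complex_vector.dim (UNIV :: 'a set)"
    using complex_vector.basis_exists[of UNIV] by metis
  then have "finite T" using assms(1) card_gt_0_iff by metis
  from complex_vector.independent_span_bound[OF this assms(2)] T show ?thesis by auto
qed

lemma orthonormal_bound:
  fixes B :: "'a::complex_hilbert_space set"
  assumes "complex_vector.dim (UNIV :: 'a set) > 0" "orthonormal B"
  shows "finite B" "card B \<le> complex_vector.dim (UNIV :: 'a set)"
  using independent_card_le_dim[OF assms(1) orthonormal_independent[OF assms(2)]] by auto

lemma subspace_orthonormal_basis:
  fixes S :: "'a::complex_hilbert_space set"
  assumes dim: "complex_vector.dim (UNIV :: 'a set) > 0" and S: "complex_vector.subspace S"
  obtains B where "orthonormal B" "finite B" "B \<subseteq> S" "\<And>x. x \<in> S \<Longrightarrow> x = (\<Sum>b\<in>B. cinner x b *\<^sub>C b)"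
proof -
  \<comment> \<open>Orthonormal subsets of \<open>S\<close> have bounded size, so a largest one
    exists. If some \<open>x\<close> in \<open>S\<close> differed from its projection, the
    normalised residual could be added to it.\<close>
  define P where "P n \<longleftrightarrow> (\<exists>B\<subseteq>S. orthonormal B \<and> card B = n)" for n
  have "P 0" unfolding P_def by (intro exI[of _ "{}"]) (auto simp: orthonormal_def)
  moreover have "\<forall>n. P n \<longrightarrow> n \<le> complex_vector.dim (UNIV :: 'a set)"
    using orthonormal_bound(2)[OF dim] unfolding P_def by auto
  ultimately obtain n where n: "P n" "\<forall>m. P m \<longrightarrow> m \<le> n"
    using Nat.ex_has_greatest_nat by metis
  then obtain B where B: "B \<subseteq> S" "orthonormal B" "card B = n" unfolding P_def by blast
  have fin: "finite B" using orthonormal_bound(1)[OF dim B(2)] .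
  have "x = (\<Sum>b\<in>B. cinner x b *\<^sub>C b)" if x: "x \<in> S" for x
  proof (rule ccontr)
    define z where "z = x - (\<Sum>b\<in>B. cinner x b *\<^sub>C b)"
    assume "x \<noteq> (\<Sum>b\<in>B. cinner x b *\<^sub>C b)"
    then have "z \<noteq> 0" by (simp add: z_def)
    then obtain k where k: "cinner (k *\<^sub>C z) (k *\<^sub>C z) = 1" by (rule ex_unit_multiple)
    have "z \<in> S" unfolding z_def
      using x B(1) S by (intro complex_vector.subspace_diff complex_vector.subspace_sum
          complex_vector.subspace_scale) auto
    then have kz: "k *\<^sub>C z \<in> S" using S by (simp add: complex_vector.subspace_scale)
    have "\<forall>b\<in>B. cinner z b = 0"
      unfolding z_def cinner_diff_left using orthonormal_coeff[OF B(2) fin] by simp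
    then have "\<forall>b\<in>B. cinner (k *\<^sub>C z) b = 0" by (simp add: cinner_scaleC_left)
    from orthonormal_insert[OF B(2) k this] have "P (Suc n)"
      unfolding P_def using B kz fin by (intro exI[of _ "insert (k *\<^sub>C z) B"]) auto
    with n show False by fastforce
  qed
  with B fin show ?thesis using that by blast
qed

lemma orthogonal_complement_subspace: "complex_vector.subspace (orthogonal_complement S)"
  by (auto simp: complex_vector.subspace_def orthogonal_complement_def cinner_simps)

lemma orthogonal_complement_decomp:
  fixes S :: "'a::complex_hilbert_space set"
  assumes dim: "complex_vector.dim (UNIV :: 'a set) > 0" and S: "complex_vector.subspace S"
  obtains u v where "u \<in> S" "v \<in> orthogonal_complement S" "x = u + v"
proof -
  obtain B where B: "orthonormal B" "finite B" "B \<subseteq> S" "\<And>x. x \<in> S \<Longrightarrow> x = (\<Sum>b\<in>B. cinner x b *\<^sub>C b)"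
    using subspace_orthonormal_basis[OF assms] by blast
  define u where "u = (\<Sum>b\<in>B. cinner x b *\<^sub>C b)"
  have "u \<in> S" unfolding u_def
    using B(3) S by (intro complex_vector.subspace_sum complex_vector.subspace_scale) auto
  moreover have "cinner (x - u) y = 0" if "y \<in> S" for y
  proof -
    have "\<forall>b\<in>B. cinner (x - u) b = 0"
      unfolding u_def cinner_diff_left using orthonormal_coeff[OF B(1,2)] by simp
    then show ?thesis by (subst B(4)[OF that]) (simp add: cinner_sum_right cinner_scaleC_right)
  qed
  then have "x - u \<in> orthogonal_complement S" by (simp add: orthogonal_complement_def)
  ultimately show ?thesis using that[of u "x - u"] by simp
qed

text \<open>Split off a root \<open>z\<close> of \<open>p\<close>, with cofactor \<open>q\<close>.
  Either \<open>T v - z *\<^sub>C v\<close> is zero and \<open>v\<close> is an eigenvector, or it is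
  a nonzero vector killed by \<open>q\<close> at \<open>T\<close>, and \<open>q\<close> has smaller
  degree.\<close>

lemma krylov_eigenvector:
  fixes T :: "'a::complex_hilbert_space \<Rightarrow> 'a"
  assumes add: "\<And>x y. x \<in> S \<Longrightarrow> y \<in> S \<Longrightarrow> T (x - y) = T x - T y"
    and scale: "\<And>a x. x \<in> S \<Longrightarrow> T (a *\<^sub>C x) = a *\<^sub>C T x"
    and S: "complex_vector.subspace S" and TS: "\<And>x. x \<in> S \<Longrightarrow> T x \<in> S"
    and "p \<noteq> 0" "v \<in> S" "v \<noteq> 0" "(\<Sum>i\<le>degree p. coeff p i *\<^sub>C (T ^^ i) v) = 0"
  shows "\<exists>u\<in>S. u \<noteq> 0 \<and> (\<exists>\<mu>. T u = \<mu> *\<^sub>C u)"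
  using assms(5-8)
proof (induction "degree p" arbitrary: p v)
  case 0
  have d: "degree p = 0" using 0(1) by (rule sym)
  have "coeff p 0 *\<^sub>C v = 0" using 0(5) unfolding d by simp
  then have "coeff p 0 = 0" using \<open>v \<noteq> 0\<close> by simp
  with d \<open>p \<noteq> 0\<close> show ?case by (metis leading_coeff_0_iff)
next
  case (Suc n)
  obtain z where z: "poly p z = 0"
    using Suc.hyps(2) by (metis fundamental_theorem_of_algebra constant_degree nat.distinct(1))
  then obtain q where q: "p = [:-z, 1:] * q" by (metis dvdE poly_eq_0_iff_dvd)
  have q0: "q \<noteq> 0" using q Suc.prems(1) by auto
  have dq: "degree p = Suc (degree q)" 
    unfolding q using degree_mult_eq[of "[:- z, 1:]" q] q0 by (simp del: mult_pCons_left)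
  let ?u = "T v - z *\<^sub>C v"
  have uS: "?u \<in> S" using S TS Suc.prems
    by (intro complex_vector.subspace_diff complex_vector.subspace_scale) auto
  have pow_S: "(T ^^ i) x \<in> S" if "x \<in> S" for i x using that by (induction i) (auto simp: TS)
  have pow: "(T ^^ i) ?u = (T ^^ Suc i) v - z *\<^sub>C (T ^^ i) v" for i
  proof (induction i)
    case (Suc i)
    have "(T ^^ Suc i) v \<in> S" "z *\<^sub>C (T ^^ i) v \<in> S" "(T ^^ i) v \<in> S"
      using pow_S[OF \<open>v \<in> S\<close>, of i] pow_S[OF \<open>v \<in> S\<close>, of "Suc i"] S
      by (auto intro: complex_vector.subspace_scale)
    with Suc show ?case by (simp add: add scale)
  qed simp
  have c: "coeff p i = (if i = 0 then 0 else coeff q (i - 1)) - z * coeff q i" for i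
    by (cases i) (simp_all add: q)
  have "(\<Sum>i\<le>degree p. coeff p i *\<^sub>C (T ^^ i) v)
      = (\<Sum>i\<le>Suc (degree q). (if i = 0 then 0 else coeff q (i - 1)) *\<^sub>C (T ^^ i) v)
        - (\<Sum>i\<le>Suc (degree q). (z * coeff q i) *\<^sub>C (T ^^ i) v)"
    by (simp add: dq c complex_vector.scale_left_diff_distrib sum_subtractf)
  also have "(\<Sum>i\<le>Suc (degree q). (if i = 0 then 0 else coeff q (i - 1)) *\<^sub>C (T ^^ i) v)
      = (\<Sum>i\<le>degree q. coeff q i *\<^sub>C (T ^^ Suc i) v)"
    by (subst sum.atMost_Suc_shift) simp
  also have "(\<Sum>i\<le>Suc (degree q). (z * coeff q i) *\<^sub>C (T ^^ i) v)
      = (\<Sum>i\<le>degree q. (z * coeff q i) *\<^sub>C (T ^^ i) v)"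
    by (simp add: coeff_eq_0)
  finally have "(\<Sum>i\<le>degree q. coeff q i *\<^sub>C (T ^^ i) ?u) = 0"
    using Suc.prems(4) by (simp add: pow complex_vector.scale_right_diff_distrib sum_subtractf
        scaleC_scaleC mult.commute)
  moreover have "n = degree q" using Suc.hyps dq by simp
  ultimately show ?case
    using Suc.hyps(1)[OF _ q0 uS] Suc.prems by (cases "?u = 0") auto
qed

lemma ex_eigenvector:
  fixes T :: "'a::complex_hilbert_space \<Rightarrow> 'a"
  assumes dim: "complex_vector.dim (UNIV :: 'a set) > 0"
    and add: "\<And>x y. x \<in> S \<Longrightarrow> y \<in> S \<Longrightarrow> T (x - y) = T x - T y"
    and scale: "\<And>a x. x \<in> S \<Longrightarrow> T (a *\<^sub>C x) = a *\<^sub>C T x"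
    and S: "complex_vector.subspace S" and TS: "\<And>x. x \<in> S \<Longrightarrow> T x \<in> S"
    and v: "v \<in> S" "v \<noteq> 0"
  shows "\<exists>u\<in>S. u \<noteq> 0 \<and> (\<exists>\<mu>. T u = \<mu> *\<^sub>C u)"
proof -
  define N where "N = complex_vector.dim (UNIV :: 'a set)"
  define f where "f i = (T ^^ i) v" for i
  \<comment> \<open>Among the \<open>N + 1\<close> iterates there is a nontrivial relation.
    Dependence is a notion for sets, so a repeated iterate is treated separately; it gives the
    relation with coefficients 1 and -1.\<close>
  have "\<exists>g. (\<exists>i\<le>N. g i \<noteq> 0) \<and> (\<Sum>i\<le>N. g i *\<^sub>C f i) = 0"
  proof (cases "inj_on f {..N}")
    case False
    then obtain i j where ij: "i \<le> N" "j \<le> N" "i \<noteq> j" "f i = f j" by (auto simp: inj_on_def)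
    define g where "g k = (if k = i then 1 else if k = j then -1 else 0 :: complex)" for k
    have "(\<Sum>k\<le>N. g k *\<^sub>C f k) = (\<Sum>k\<in>{i,j}. g k *\<^sub>C f k)"
      using ij by (intro sum.mono_neutral_right) (auto simp: g_def)
    also have "\<dots> = 0" using ij by (simp add: g_def)
    finally show ?thesis using ij by (intro exI[of _ g]) (auto simp: g_def)
  next
    case True
    have "complex_vector.dependent (f ` {..N})"
    proof (rule ccontr)
      assume "\<not> ?thesis"
      from independent_card_le_dim[OF dim this] show False
        using card_image[OF True] by (simp add: N_def)
    qed
    then obtain u x where u: "(\<Sum>w\<in>f ` {..N}. u w *\<^sub>C w) = 0" "x \<le> N" "u (f x) \<noteq> 0"
      by (subst (asm) complex_vector.dependent_finite) auto
    then show ?thesis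
      by (intro exI[of _ "u \<circ> f"]) (auto simp: sum.reindex[OF True])
  qed
  then obtain g where g: "\<exists>i\<le>N. g i \<noteq> 0" "(\<Sum>i\<le>N. g i *\<^sub>C f i) = 0" by blast
  define p where "p = (\<Sum>i\<le>N. monom (g i) i)"
  have c: "coeff p i = (if i \<le> N then g i else 0)" for i
    by (simp add: p_def coeff_sum sum.delta)
  have "p \<noteq> 0" using g(1) c by (metis coeff_0)
  have "degree p \<le> N" by (intro degree_le) (simp add: c)
  then have "(\<Sum>i\<le>degree p. coeff p i *\<^sub>C (T ^^ i) v) = (\<Sum>i\<le>N. coeff p i *\<^sub>C (T ^^ i) v)"
    by (intro sum.mono_neutral_left) (auto simp: coeff_eq_0)
  also have "\<dots> = 0" using g(2) by (simp add: c f_def)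
  finally show ?thesis
    using krylov_eigenvector[of S T, OF add scale S TS \<open>p \<noteq> 0\<close> v] by blast
qed

locale finite_dim_operator =
  fixes A :: "'a::complex_hilbert_space \<Rightarrow> 'a"
  assumes dim_pos: "complex_vector.dim (UNIV :: 'a set) > 0"
    and A_add: "A (x + y) = A x + A y"
    and A_scale: "A (k *\<^sub>C x) = k *\<^sub>C A x"
begin

lemma A_diff: "A (x - y) = A x - A y"
  using A_add[of "x - y" y] by simp

lemma A_zero [simp]: "A 0 = 0"
  using A_add[of 0 0] by simp

lemma A_sum: "A (\<Sum>i\<in>I. f i) = (\<Sum>i\<in>I. A (f i))"
  by (induction I rule: infinite_finite_induct) (simp_all add: A_add)

text \<open>\<open>e\<close> is an eigenvector of the compression of \<open>A\<close> to \<open>S\<close>.\<close>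

lemma compression_eigenvector:
  assumes S: "complex_vector.subspace S" and v: "v \<in> S" "v \<noteq> 0"
  obtains e where "e \<in> S" "cinner e e = 1" "\<And>y. y \<in> S \<Longrightarrow> cinner e y = 0 \<Longrightarrow> cinner (A e) y = 0"
proof -
  obtain B where B: "orthonormal B" "finite B" "B \<subseteq> S" "\<And>x. x \<in> S \<Longrightarrow> x = (\<Sum>b\<in>B. cinner x b *\<^sub>C b)"
    using subspace_orthonormal_basis[OF dim_pos S] by blast
  \<comment> \<open>The orthogonal projection of \<open>A x\<close> onto \<open>S\<close>; for
    \<open>y\<close> in \<open>S\<close> it has the same inner product with \<open>y\<close> as
    \<open>A x\<close>.\<close>
  define T where "T x = (\<Sum>b\<in>B. cinner (A x) b *\<^sub>C b)" for x
  have "\<exists>u\<in>S. u \<noteq> 0 \<and> (\<exists>\<mu>. T u = \<mu> *\<^sub>C u)"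
  proof (rule ex_eigenvector[OF dim_pos _ _ S _ v])
    show "T (x - y) = T x - T y" for x y
      by (simp add: T_def A_diff cinner_diff_left complex_vector.scale_left_diff_distrib sum_subtractf)
    show "T (a *\<^sub>C x) = a *\<^sub>C T x" for a x
      by (simp add: T_def A_scale cinner_scaleC_left complex_vector.scale_sum_right scaleC_scaleC)
    show "T x \<in> S" for x
      unfolding T_def using B(3) S
      by (intro complex_vector.subspace_sum complex_vector.subspace_scale) auto
  qed
  then obtain u \<mu> where u: "u \<in> S" "u \<noteq> 0" "T u = \<mu> *\<^sub>C u" by blast
  obtain k where k: "cinner (k *\<^sub>C u) (k *\<^sub>C u) = 1" using ex_unit_multiple[OF u(2)] .
  have "cinner (A (k *\<^sub>C u)) y = 0" if y: "y \<in> S" "cinner (k *\<^sub>C u) y = 0" for y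
  proof -
    have "cinner (A u) y = cinner (A u) (\<Sum>b\<in>B. cinner y b *\<^sub>C b)"
      using B(4)[OF y(1)] by simp
    also have "\<dots> = (\<Sum>b\<in>B. cinner (A u) b * cinner b y)"
      by (simp add: cinner_sum_right cinner_scaleC_right cinner_commute[of _ y, symmetric] mult.commute)
    also have "\<dots> = cinner (T u) y" by (simp add: T_def cinner_sum_left cinner_scaleC_left)
    also have "\<dots> = \<mu> * cinner u y" by (simp add: u cinner_scaleC_left)
    finally show ?thesis using y(2) by (auto simp: cinner_scaleC_left A_scale)
  qed
  with that[of "k *\<^sub>C u"] u k S show ?thesis by (simp add: complex_vector.subspace_scale)
qed

end

section \<open>The pencil of a triangular matrix\<close>

lemma det_4:
  "det (A :: 'a::comm_ring_1^4^4) =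
    A$1$1 * A$2$2 * A$3$3 * A$4$4
    - A$1$1 * A$2$2 * A$3$4 * A$4$3
    - A$1$1 * A$2$3 * A$3$2 * A$4$4
    + A$1$1 * A$2$3 * A$3$4 * A$4$2
    + A$1$1 * A$2$4 * A$3$2 * A$4$3
    - A$1$1 * A$2$4 * A$3$3 * A$4$2
    - A$1$2 * A$2$1 * A$3$3 * A$4$4
    + A$1$2 * A$2$1 * A$3$4 * A$4$3
    + A$1$2 * A$2$3 * A$3$1 * A$4$4
    - A$1$2 * A$2$3 * A$3$4 * A$4$1
    - A$1$2 * A$2$4 * A$3$1 * A$4$3
    + A$1$2 * A$2$4 * A$3$3 * A$4$1
    + A$1$3 * A$2$1 * A$3$2 * A$4$4
    - A$1$3 * A$2$1 * A$3$4 * A$4$2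
    - A$1$3 * A$2$2 * A$3$1 * A$4$4
    + A$1$3 * A$2$2 * A$3$4 * A$4$1
    + A$1$3 * A$2$4 * A$3$1 * A$4$2
    - A$1$3 * A$2$4 * A$3$2 * A$4$1
    - A$1$4 * A$2$1 * A$3$2 * A$4$3
    + A$1$4 * A$2$1 * A$3$3 * A$4$2
    + A$1$4 * A$2$2 * A$3$1 * A$4$3
    - A$1$4 * A$2$2 * A$3$3 * A$4$1
    - A$1$4 * A$2$3 * A$3$1 * A$4$2
    + A$1$4 * A$2$3 * A$3$2 * A$4$1"
proof -
  have f1: "finite {2::4, 3, 4}" "1 \<notin> {2::4, 3, 4}" by auto
  have f2: "finite {3::4, 4}" "2 \<notin> {3::4, 4}" by auto
  have f3: "finite {4::4}" "3 \<notin> {4::4}" by auto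
  show ?thesis
    unfolding det_def UNIV_4
    unfolding sum_over_permutations_insert[OF f1]
    unfolding sum_over_permutations_insert[OF f2]
    unfolding sum_over_permutations_insert[OF f3]
    unfolding permutes_sing
    by (simp add: sign_swap_id sign_id swap_id_eq sign_compose permutation_swap_id
        permutation_compose)
qed


lemma poly_det: "poly (det P) t = det (\<chi> i j. poly (P$i$j) t)"
  by (simp add: det_def poly_sum poly_prod of_int_poly poly_mult)

lemma infinite_unit_circle: "infinite {t :: complex. cmod t = 1}"
proof -
  have "{t :: complex. cmod t = 1} = sphere 0 1" by (auto simp: dist_norm)
  moreover have "connected (sphere 0 1 :: complex set)" by (rule connected_sphere) simp
  ultimately have "connected {t :: complex. cmod t = 1}" by simp
  moreover have "1 \<in> {t :: complex. cmod t = 1}" "-1 \<in> {t :: complex. cmod t = 1}" by auto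
  ultimately show ?thesis
    using connected_finite_iff_sing by (metis empty_iff one_neq_neg_one singletonD)
qed

definition pencil :: "complex \<Rightarrow> complex^'n^'n \<Rightarrow> complex \<Rightarrow> complex^'n^'n" where
  "pencil w C t = (\<chi> j l. w * t\<^sup>2 * C$j$l + w * cnj (C$l$j) + (if j = l then w\<^sup>2 - t\<^sup>2 else 0)
     + t\<^sup>2 * (\<Sum>i\<in>UNIV. C$i$l * cnj (C$i$j)))"

text \<open>Conjugates fall only on constants, so the determinant is a polynomial in
  \<open>t\<close>. Multiplying it by \<open>W\<close> absorbs the excluded points; the product
  vanishes on the infinite unit circle, and \<open>W\<close> is nonzero because its constant term is
  \<open>- cnj c\<close>.\<close>

lemma det_pencil_zero_everywhere:
  fixes r :: complex
  assumes "c \<noteq> 0"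
    and "\<And>t. cmod t = 1 \<Longrightarrow> 2*r*t - c*t\<^sup>2 - cnj c \<noteq> 0 \<Longrightarrow> det (pencil (2*r*t - c*t\<^sup>2 - cnj c) C t) = 0"
  shows "det (pencil (2*r*t - c*t\<^sup>2 - cnj c) C t) = 0"
proof -
  define W where "W = [:- cnj c, 2*r, -c:]"
  have W: "poly W t = 2*r*t - c*t\<^sup>2 - cnj c" for t
    by (simp add: W_def algebra_simps power2_eq_square)
  define P where "P = (\<chi> j l. W * [:0,0,1:] * [:C$j$l:] + W * [:cnj (C$l$j):]
     + (if j = l then W\<^sup>2 - [:0,0,1:] else 0) + [:0,0,1:] * [:\<Sum>i\<in>UNIV. C$i$l * cnj (C$i$j):])"
  have P: "poly (det P) t = det (pencil (poly W t) C t)" for t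
    unfolding poly_det pencil_def P_def
    by (rule arg_cong[where f = det]) (simp add: vec_eq_iff power2_eq_square algebra_simps)
  have "poly (det P * W) t = 0" if "cmod t = 1" for t
    using assms(2)[OF that] by (auto simp: P W)
  then have "{t. cmod t = 1} \<subseteq> {t. poly (det P * W) t = 0}" by auto
  then have "det P * W = 0"
    using infinite_unit_circle poly_roots_finite finite_subset by metis
  moreover have "W \<noteq> 0" using assms(1) by (simp add: W_def)
  ultimately have "det P = 0" by simp
  then show ?thesis using P[of t] by (simp add: W)
qed

text \<open>With \<open>L = C\<^sup>* + w\<close> the pencil is \<open>L (w + t\<^sup>2 C) - t\<^sup>2\<close>; multiplying by \<open>w - t\<^sup>2 C\<close> replaces the
  factor \<open>w + t\<^sup>2 C\<close> by a scalar up to order four.\<close>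

lemma pencil_mult:
  fixes C :: "complex^4^4"
  shows "(pencil w C t ** (\<chi> i j. (if i = j then w else 0) - t\<^sup>2 * C$i$j))$i$j =
    w\<^sup>2 * cnj (C$j$i) + (if i = j then w^3 - t\<^sup>2 * w else 0)
    + t^4 * (C$i$j - w * (\<Sum>m\<in>UNIV. C$i$m * C$m$j)
        - (\<Sum>k\<in>UNIV. \<Sum>m\<in>UNIV. cnj (C$k$i) * C$k$m * C$m$j))"
proof -
  have t4: "t^4 = t\<^sup>2 * t\<^sup>2" by (simp add: power2_eq_square power4_eq_xxxx)
  have w3: "w^3 = w * w\<^sup>2" by (simp add: power2_eq_square power3_eq_cube)
  have "\<forall>i j. (pencil w C t ** (\<chi> i j. (if i = j then w else 0) - t\<^sup>2 * C$i$j))$i$j =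
    w\<^sup>2 * cnj (C$j$i) + (if i = j then w^3 - t\<^sup>2 * w else 0)
    + t^4 * (C$i$j - w * (\<Sum>m\<in>UNIV. C$i$m * C$m$j)
        - (\<Sum>k\<in>UNIV. \<Sum>m\<in>UNIV. cnj (C$k$i) * C$k$m * C$m$j))"
    unfolding forall_4 pencil_def matrix_matrix_mult_def t4 w3
    by (simp add: sum_4, intro conjI; algebra)
  then show ?thesis by blast
qed

text \<open>Allows a power of \<open>t\<close> to be cancelled for \<open>t \<noteq> 0\<close> and
  the quotient to be read off at 0.\<close>

lemma continuous_zero_at_0:
  fixes f :: "complex \<Rightarrow> complex"
  assumes "continuous_on UNIV f" "\<And>t. t \<noteq> 0 \<Longrightarrow> f t = 0"
  shows "f 0 = 0"
proof -
  have "(f \<longlongrightarrow> f 0) (at 0)" using assms(1) by (simp add: continuous_on_def)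
  moreover have "(f \<longlongrightarrow> 0) (at 0)"
    using assms(2) by (intro tendsto_eventually) (simp add: eventually_at_filter)
  ultimately show ?thesis by (rule tendsto_unique[OF trivial_limit_at])
qed


text \<open>The product in \<open>pencil_mult\<close> is lower triangular modulo \<open>t^4\<close>,
  so its determinant is the product of the diagonal entries modulo \<open>t^4\<close>. Each entry
  has order 0 or 1 at 0, hence all four must have order 1; comparing coefficients of
  \<open>t^4\<close> gives the second claim.\<close>

lemma triangular_pencil:
  fixes C :: "complex^4^4" and r :: complex
  assumes tri: "C$2$1 = 0" "C$3$1 = 0" "C$4$1 = 0" "C$3$2 = 0" "C$4$2 = 0" "C$4$3 = 0"
    and "r \<noteq> 0" "c \<noteq> 0"
    and sing: "\<And>t. cmod t = 1 \<Longrightarrow> 2*r*t - c*t\<^sup>2 - cnj c \<noteq> 0 \<Longrightarrow>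
      det (pencil (2*r*t - c*t\<^sup>2 - cnj c) C t) = 0"
  shows "C$i$i = c" "16 * r^4 * (cnj c)\<^sup>2 = C$1$4 * cnj (C$1$2 * C$2$3 * C$3$4)"
proof -
  define W where "W t = 2*r*t - c*t\<^sup>2 - cnj c" for t
  define Z where "Z i j t = C$i$j - W t * (\<Sum>m\<in>UNIV. C$i$m * C$m$j)
        - (\<Sum>k\<in>UNIV. \<Sum>m\<in>UNIV. cnj (C$k$i) * C$k$m * C$m$j)" for i j t
  define G where "G t = pencil (W t) C t ** (\<chi> i j. (if i = j then W t else 0) - t\<^sup>2 * C$i$j)" for t
  have det0: "det (G t) = 0" for t
    using det_pencil_zero_everywhere[OF \<open>c \<noteq> 0\<close> sing] by (simp add: G_def det_mul W_def)
  have G: "G t$i$j = (W t)\<^sup>2 * cnj (C$j$i) + (if i = j then W t^3 - t\<^sup>2 * W t else 0) + t^4 * Z i j t"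
    for i j t unfolding G_def pencil_mult Z_def by simp
  have cW: "continuous_on UNIV W" unfolding W_def by (intro continuous_intros)
  have cZ: "continuous_on UNIV (Z i j)" for i j unfolding Z_def by (intro continuous_intros cW)
  \<comment> \<open>Write one factor of \<open>W t^3\<close> as
    \<open>- cnj c + t * (2*r - c*t)\<close>. The diagonal entry \<open>b i\<close> of
    \<open>G\<close> then splits into \<open>d i\<close>, which measures whether
    \<open>C$i$i\<close> is \<open>c\<close>, and a remainder divisible by \<open>t\<close>.\<close>
  define d where "d i = cnj (C$i$i) - cnj c" for i
  define g where "g i t = (W t)\<^sup>2 * (2*r - c*t) - t * W t + t^3 * Z i i t" for i t
  define b where "b i t = (W t)\<^sup>2 * d i + t * g i t" for i t
  \<comment> \<open>The diagonal entry with its exact power \<open>t ^ J i\<close> removed, so that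
    \<open>f i 0\<close> is nonzero.\<close>
  define f where "f i t = (if d i = 0 then g i t else b i t)" for i t
  define J where "J i = (if d i = 0 then 1 else 0 :: nat)" for i
  define a where "a i j t = (W t)\<^sup>2 * cnj (C$j$i) + t^4 * Z i j t" for i j t
  have cg: "continuous_on UNIV (g i)" for i
    unfolding g_def by (intro continuous_intros cW cZ)
  have cb: "continuous_on UNIV (b i)" for i
    unfolding b_def by (intro continuous_intros cW cg)
  have cf: "continuous_on UNIV (f i)" for i
    unfolding f_def using cg[of i] cb[of i] by (cases "d i = 0") simp_all
  have ca: "continuous_on UNIV (a i j)" for i j
    unfolding a_def by (intro continuous_intros cW cZ)
  have bf: "b i t = t ^ J i * f i t" for i t by (simp add: f_def J_def b_def)
  have diag: "G t$i$i = b i t" for i t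
    unfolding G b_def g_def d_def by (simp add: W_def) algebra
  have lower: "G t$2$1 = a 2 1 t" "G t$3$1 = a 3 1 t" "G t$4$1 = a 4 1 t" "G t$3$2 = a 3 2 t"
    "G t$4$2 = a 4 2 t" "G t$4$3 = a 4 3 t" for t unfolding G a_def by simp_all
  have upper: "G t$1$2 = t^4 * Z 1 2 t" "G t$1$3 = t^4 * Z 1 3 t" "G t$1$4 = t^4 * Z 1 4 t"
    "G t$2$3 = t^4 * Z 2 3 t" "G t$2$4 = t^4 * Z 2 4 t" "G t$3$4 = t^4 * Z 3 4 t" for t
    unfolding G using tri by simp_all
  \<comment> \<open>Every permutation other than the identity moves some index upwards, so all other terms of the
    determinant carry a factor \<open>t^4\<close>.\<close>
  define X where "X t = 0 - b 1 t * b 2 t * Z 3 4 t * a 4 3 t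
      - b 1 t * Z 2 3 t * a 3 2 t * b 4 t
      + t^4 * b 1 t * Z 2 3 t * Z 3 4 t * a 4 2 t
      + b 1 t * Z 2 4 t * a 3 2 t * a 4 3 t
      - b 1 t * Z 2 4 t * b 3 t * a 4 2 t
      - Z 1 2 t * a 2 1 t * b 3 t * b 4 t
      + t^4 * Z 1 2 t * a 2 1 t * Z 3 4 t * a 4 3 t
      + t^4 * Z 1 2 t * Z 2 3 t * a 3 1 t * b 4 t
      - t^8 * Z 1 2 t * Z 2 3 t * Z 3 4 t * a 4 1 t
      - t^4 * Z 1 2 t * Z 2 4 t * a 3 1 t * a 4 3 t
      + t^4 * Z 1 2 t * Z 2 4 t * b 3 t * a 4 1 t
      + Z 1 3 t * a 2 1 t * a 3 2 t * b 4 t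
      - t^4 * Z 1 3 t * a 2 1 t * Z 3 4 t * a 4 2 t
      - Z 1 3 t * b 2 t * a 3 1 t * b 4 t
      + t^4 * Z 1 3 t * b 2 t * Z 3 4 t * a 4 1 t
      + t^4 * Z 1 3 t * Z 2 4 t * a 3 1 t * a 4 2 t
      - t^4 * Z 1 3 t * Z 2 4 t * a 3 2 t * a 4 1 t
      - Z 1 4 t * a 2 1 t * a 3 2 t * a 4 3 t
      + Z 1 4 t * a 2 1 t * b 3 t * a 4 2 t
      + Z 1 4 t * b 2 t * a 3 1 t * a 4 3 t
      - Z 1 4 t * b 2 t * b 3 t * a 4 1 t
      - t^4 * Z 1 4 t * Z 2 3 t * a 3 1 t * a 4 2 t
      + t^4 * Z 1 4 t * Z 2 3 t * a 3 2 t * a 4 1 t" for t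
  have cX: "continuous_on UNIV X"
    unfolding X_def by (intro continuous_intros cZ ca cb)
  have "det (G t) = b 1 t * b 2 t * b 3 t * b 4 t + t^4 * X t" for t
    unfolding det_4 diag lower upper X_def by algebra
  then have expand: "b 1 t * b 2 t * b 3 t * b 4 t + t^4 * X t = 0" for t using det0 by simp
  \<comment> \<open>The number of diagonal entries of \<open>C\<close> equal to \<open>c\<close>.
    After division by \<open>t^K\<close> the term with \<open>X\<close> survives at 0 only if
    \<open>K = 4\<close>.\<close>
  define K where "K = J 1 + J 2 + J 3 + J 4"
  have K4: "K \<le> 4" by (simp add: K_def J_def)
  have "f 1 t * f 2 t * f 3 t * f 4 t + t^(4 - K) * X t = 0" if "t \<noteq> 0" for t
  proof -
    have "t^K * (f 1 t * f 2 t * f 3 t * f 4 t + t^(4 - K) * X t)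
        = b 1 t * b 2 t * b 3 t * b 4 t + t^(K + (4 - K)) * X t"
      unfolding bf K_def by (simp add: power_add algebra_simps)
    also have "\<dots> = 0" using expand[of t] K4 by simp
    finally show ?thesis using that by simp
  qed
  moreover have "continuous_on UNIV (\<lambda>t. f 1 t * f 2 t * f 3 t * f 4 t + t^(4 - K) * X t)"
    by (intro continuous_intros cf cX)
  ultimately have lim: "f 1 0 * f 2 0 * f 3 0 * f 4 0 + 0^(4 - K) * X 0 = 0"
    using continuous_zero_at_0[of "\<lambda>t. f 1 t * f 2 t * f 3 t * f 4 t + t^(4 - K) * X t"] by blast
  have W0: "W 0 = - cnj c" by (simp add: W_def)
  have f0: "f i 0 \<noteq> 0" for i
    using \<open>r \<noteq> 0\<close> \<open>c \<noteq> 0\<close> by (simp add: f_def g_def b_def W0)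
  have "K = 4"
  proof (rule ccontr)
    assume "K \<noteq> 4"
    then have "0 < 4 - K" using K4 by simp
    then have "f 1 0 * f 2 0 * f 3 0 * f 4 0 = 0" using lim by (simp add: zero_power)
    then show False using f0 by simp
  qed
  moreover have J1: "J i \<le> 1" for i by (simp add: J_def)
  ultimately have "J 1 = 1 \<and> J 2 = 1 \<and> J 3 = 1 \<and> J 4 = 1"
    unfolding K_def using J1[of 1] J1[of 2] J1[of 3] J1[of 4] by linarith
  then have "J i = 1" for i unfolding forall_4[of "\<lambda>i. J i = 1", symmetric] by (rule spec)
  then have d0: "d i = 0" for i unfolding J_def by (metis zero_neq_one)
  then have C: "C$i$i = c" for i unfolding d_def by (metis complex_cnj_cnj eq_iff_diff_eq_0)
  then show "C$i$i = c" .
  have b0: "b i 0 = 0" for i by (simp add: b_def d0)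
  \<comment> \<open>The first column of \<open>C\<close> is \<open>c\<close> times a unit vector, so
    at \<open>W 0 = - cnj c\<close> the contributions of \<open>C C\<close> and
    \<open>C\<^sup>* C C\<close> cancel.\<close>
  have Z14: "Z 1 4 0 = C$1$4" unfolding Z_def W0 using tri by (simp add: sum_4 C algebra_simps)
  have "f i 0 = 2 * r * (cnj c)\<^sup>2" for i by (simp add: f_def d0 g_def W0 mult_ac)
  with lim \<open>K = 4\<close> have "(2 * r * (cnj c)\<^sup>2)^4 + X 0 = 0" by (simp add: power4_eq_xxxx)
  \<comment> \<open>All terms containing some \<open>b i\<close> or a power of \<open>t\<close>
    vanish; only the 4-cycle through the corner and the subdiagonal is left.\<close>
  moreover have "X 0 = - C$1$4 * (cnj c)^6 * cnj (C$1$2 * C$2$3 * C$3$4)"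
    unfolding X_def b0 Z14 a_def W0 by (simp add: power_def)
  moreover have "(2 * r * (cnj c)\<^sup>2)^4 = (cnj c)^6 * (16 * r^4 * (cnj c)\<^sup>2)" by algebra
  ultimately have "(cnj c)^6 * (16 * r^4 * (cnj c)\<^sup>2 - C$1$4 * cnj (C$1$2 * C$2$3 * C$3$4)) = 0"
    by (simp add: right_diff_distrib mult_ac)
  then show "16 * r^4 * (cnj c)\<^sup>2 = C$1$4 * cnj (C$1$2 * C$2$3 * C$3$4)"
    using \<open>c \<noteq> 0\<close> by simp
qed

section \<open>Partial isometries whose numerical range is a disk\<close>

text \<open>The assumption \<open>c \<noteq> 0\<close>, which is to be refuted, is built in.
  Dimension five is supplied later, where orthonormal vectors are counted.\<close>

locale circular_partial_isometry = finite_dim_operator A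
  for A :: "'a::complex_hilbert_space \<Rightarrow> 'a" +
  fixes c :: complex and r :: real
  assumes iso: "x \<in> orthogonal_complement (kernel A) \<Longrightarrow> norm (A x) = norm x"
    and r_pos: "r > 0" and c_nz: "c \<noteq> 0"
    and disk: "numerical_range A = cball c r"
begin

abbreviation E :: "'a set" where "E \<equiv> orthogonal_complement (kernel A)"

lemma kernel_subspace: "complex_vector.subspace (kernel A)"
  by (simp add: complex_vector.subspace_def kernel_def A_add A_scale)

lemma kernel_decomp:
  obtains x0 x1 where "A x0 = 0" "x1 \<in> E" "x = x0 + x1"
  using orthogonal_complement_decomp[OF dim_pos kernel_subspace, of x thesis] by (auto simp: kernel_def)

lemma E_kernel: "x \<in> E \<Longrightarrow> A y = 0 \<Longrightarrow> cinner x y = 0" "x \<in> E \<Longrightarrow> A y = 0 \<Longrightarrow> cinner y x = 0"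
  using cinner_eq_0_commute by (auto simp: orthogonal_complement_def kernel_def)

text \<open>Polarisation: preservation of the norm of \<open>x + k *\<^sub>C y\<close> kills the
  real part of the defect \<open>D\<close> for \<open>k = 1\<close> and its imaginary part for
  \<open>k = \<i>\<close>.\<close>

lemma cinner_iso:
  assumes "x \<in> E" "y \<in> E"
  shows "cinner (A x) (A y) = cinner x y"
proof -
  define D where "D = cinner (A x) (A y) - cinner x y"
  have self: "cinner (A z) (A z) = cinner z z" if "z \<in> E" for z
    using iso[OF that] by (simp add: cinner_self)
  have D': "cnj D = cinner (A y) (A x) - cinner y x"
    by (simp add: D_def cinner_commute[of y x] cinner_commute[of "A y" "A x"])
  have *: "cnj k * D + k * cnj D = 0" for k
  proof -
    have "x + k *\<^sub>C y \<in> E" using assms orthogonal_complement_subspace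
      by (intro complex_vector.subspace_add complex_vector.subspace_scale)
    from self[OF this] self[OF assms(1)] self[OF assms(2)] show ?thesis
      unfolding D' unfolding D_def by (simp add: A_add A_scale cinner_simps algebra_simps)
  qed
  from *[of 1] *[of \<i>] have "D + cnj D = 0" "D - cnj D = 0" by (simp_all add: algebra_simps)
  then show ?thesis unfolding D_def by (auto simp: complex_eq_iff)
qed

lemma ex_numerical_value:
  assumes "z \<in> cball c r"
  obtains x where "norm x = 1" "cinner (A x) x = z"
  using assms unfolding disk[symmetric] numerical_range_def by auto

lemma numerical_bound: "cmod (cinner (A x) x - c * cinner x x) \<le> r * (norm x)\<^sup>2"
proof (cases "x = 0")
  case False
  define z where "z = (1 / of_real (norm x)) *\<^sub>C x"
  have z: "norm z = 1" using False by (simp add: z_def norm_scaleC norm_divide)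
  then have "cinner (A z) z \<in> cball c r" using disk unfolding numerical_range_def by blast
  then have "cmod (cinner (A z) z - c) \<le> r" by (simp add: dist_norm norm_minus_commute)
  moreover have "cinner (A x) x - c * cinner x x = (cinner (A z) z - c) * of_real ((norm x)\<^sup>2)"
    using False by (simp add: z_def A_scale cinner_simps cinner_self[of x] field_simps power2_eq_square)
  ultimately show ?thesis by (simp add: norm_mult mult_right_mono norm_power)
qed simp

text \<open>A unit vector attaining the boundary point \<open>c - r t\<^sup>-\<^sup>1\<close> is a null vector of a positive
  semidefinite Hermitian form; the equation is that form multiplied by \<open>t\<close>.\<close>

lemma extremal_vector:
  fixes t :: complex
  assumes t: "cmod t = 1"
  obtains x where "x \<noteq> 0"
    "\<And>y. t\<^sup>2 * cinner (A x) y + cinner x (A y) + (2 * complex_of_real r * t - c * t\<^sup>2 - cnj c) * cinner x y = 0"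
proof -
  have tt: "t * cnj t = 1" using t by (simp add: complex_norm_square[symmetric])
  have "c - r * cnj t \<in> cball c r" using t r_pos by (simp add: dist_norm norm_mult)
  then obtain x where x: "norm x = 1" "cinner (A x) x = c - r * cnj t"
    by (rule ex_numerical_value)
  have xx: "cinner x x = 1" using x by (simp add: cinner_self)
  define H where "H x y = t * cinner (A x) y + cnj t * cinner x (A y)
    + (2 * r - t * c - cnj (t * c)) * cinner x y" for x y
  have H_comm: "H y x = cnj (H x y)" for x y
    unfolding H_def by (simp add: cinner_commute[of "A y" x] cinner_commute[of y "A x"]
        cinner_commute[of y x])
  have H_self: "H x x = of_real (2 * (Re (t * (cinner (A x) x - c * cinner x x)) + r * (norm x)\<^sup>2))" for x
    unfolding H_def cinner_commute[of x "A x"] cinner_self[of x]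
    by (simp add: complex_eq_iff algebra_simps)
  have H_pos: "Re (H x x) \<ge> 0" for x
  proof -
    have "\<bar>Re (t * (cinner (A x) x - c * cinner x x))\<bar> \<le> cmod (t * (cinner (A x) x - c * cinner x x))"
      by (rule abs_Re_le_cmod)
    also have "\<dots> \<le> r * (norm x)\<^sup>2" using numerical_bound[of x] t by (simp add: norm_mult)
    finally show ?thesis unfolding H_self by simp
  qed
  have H0: "H x x = 0"
  proof -
    have "t * (cinner (A x) x - c * cinner x x) = - (of_real r * (t * cnj t))" by (simp add: x xx)
    then show ?thesis unfolding H_self tt by (simp add: x)
  qed
  have "H x y = 0" for y
  proof (rule ccontr)
    assume nz: "H x y \<noteq> 0"
    define h where "h = H x y"
    \<comment> \<open>A step size small enough that the negative first-order term beats the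
      quadratic one, also when \<open>H y y\<close> is 0.\<close>
    define e where "e = 1 / (1 + Re (H y y))"
    have e: "0 < e" "e * Re (H y y) < 1" using H_pos[of y] by (simp_all add: e_def field_simps)
    define k where "k = of_real e * h"
    have "H (x - k *\<^sub>C y) (x - k *\<^sub>C y) = H x x - cnj k * H x y - k * H y x + k * cnj k * H y y"
      unfolding H_def by (simp add: A_diff A_scale cinner_simps algebra_simps)
    also have "\<dots> = h * cnj h * (of_real (e\<^sup>2) * H y y - of_real (2 * e))"
      unfolding H0 H_comm[of y x] h_def[symmetric] k_def by (simp add: algebra_simps power2_eq_square)
    also have "Re \<dots> = (cmod h)\<^sup>2 * (e * (e * Re (H y y) - 2))"
      unfolding complex_norm_square[symmetric] by (simp add: algebra_simps power2_eq_square)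
    finally have "0 \<le> (cmod h)\<^sup>2 * (e * (e * Re (H y y) - 2))"
      using H_pos[of "x - k *\<^sub>C y"] by simp
    moreover have "(cmod h)\<^sup>2 > 0" using nz by (simp add: h_def)
    moreover have "e * (e * Re (H y y) - 2) < 0" using e by (intro mult_pos_neg) auto
    ultimately show False using mult_pos_neg not_less by blast
  qed
  then have "t * H x y = 0" for y by simp
  moreover have "t * H x y = t\<^sup>2 * cinner (A x) y + cinner x (A y)
      + (2 * complex_of_real r * t - c * t\<^sup>2 - cnj c) * cinner x y" for y
    unfolding H_def distrib_left mult.assoc[symmetric] tt using tt
    by (simp add: algebra_simps power2_eq_square)
  moreover have "x \<noteq> 0" using x by auto
  ultimately show ?thesis using that by metis
qed

text \<open>A unitary \<open>A\<close> has its numerical range in the unit disk and its eigenvalues on the unit circle.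
  A disk centred at \<open>c \<noteq> 0\<close> touches that circle from inside in at most one point, so \<open>A\<close> would be
  scalar.\<close>

lemma kernel_nontrivial: "\<exists>k. cinner k k = 1 \<and> A k = 0"
proof (rule ccontr)
  assume "\<not> ?thesis"
  then have inj: "x = 0" if "A x = 0" for x
    using that ex_unit_multiple[of x] A_scale complex_vector.scale_zero_right by metis
  then have "kernel A = {0}" by (auto simp: kernel_def)
  then have E: "E = UNIV" by (auto simp: orthogonal_complement_def)
  have iso': "cinner (A x) (A y) = cinner x y" for x y using cinner_iso by (simp add: E)
  define u where "u = c / cmod c"
  have u: "u * cnj u = 1" unfolding u_def
    using c_nz by (simp add: complex_norm_square[symmetric] power2_eq_square)
  have "c + r * u \<in> cball c r" using r_pos c_nz by (simp add: dist_norm u_def norm_mult norm_divide)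
  then obtain x where x: "norm x = 1" "cinner (A x) x = c + r * u"
    by (rule ex_numerical_value)
  define p where "p = c + r * u"
  \<comment> \<open>Here \<open>p\<close> is the point of the disk farthest from the origin; the
    squared norm of \<open>A x - p *\<^sub>C x\<close> being nonnegative confines the disk to the
    unit disk.\<close>
  have "cinner (A x - p *\<^sub>C x) (A x - p *\<^sub>C x) = 1 - p * cnj p"
    using x by (simp add: cinner_simps iso' cinner_self[of x] cinner_commute[of x "A x"] p_def[symmetric])
  also have "\<dots> = of_real (1 - (cmod p)\<^sup>2)" by (simp add: complex_norm_square[symmetric])
  finally have "0 \<le> 1 - (cmod p)\<^sup>2" using cinner_ge_zero[of "A x - p *\<^sub>C x"] by simp
  then have "cmod p \<le> 1" by (simp add: abs_square_le_1)
  moreover have "p = of_real (cmod c + r) * u" using c_nz by (simp add: p_def u_def algebra_simps)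
  ultimately have cr: "cmod c + r \<le> 1"
    using r_pos c_nz by (simp add: norm_mult u_def norm_divide del: of_real_add)
  \<comment> \<open>An eigenvalue has modulus 1 and distance at most \<open>1 - cmod c\<close> from
    \<open>c\<close>. This is the equality case of the triangle inequality, so it points in the
    direction of \<open>c\<close>.\<close>
  have eig: "\<mu> = u" if e: "cinner e e = 1" "A e = \<mu> *\<^sub>C e" for e \<mu>
  proof -
    have "norm (A e) = norm e" using iso[of e] E by simp
    moreover have e1: "norm e = 1" using e(1) by (simp add: norm_eq_sqrt_cinner)
    ultimately have m: "cmod \<mu> = 1" using e(2) by (simp add: norm_scaleC)
    have "cmod (\<mu> - c) \<le> r"
      using numerical_bound[of e] e e1 by (simp add: cinner_simps)
    then have "cmod (\<mu> - c) \<le> 1 - cmod c" using cr by simp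
    then have "(cmod (\<mu> - c))\<^sup>2 \<le> (1 - cmod c)\<^sup>2" by (rule power_mono) simp
    moreover have "(cmod (\<mu> - c))\<^sup>2 = (cmod \<mu>)\<^sup>2 - 2 * Re (\<mu> * cnj c) + (cmod c)\<^sup>2"
      unfolding cmod_power2 by (simp add: power2_eq_square algebra_simps)
    ultimately have "Re (\<mu> * cnj c) \<ge> cmod (\<mu> * cnj c)"
      by (simp add: m norm_mult power2_eq_square algebra_simps)
    then have "\<mu> * cnj c = cmod (\<mu> * cnj c)"
      by (smt (verit) complex_eq_iff cmod_eq_Re complex_Re_le_cmod cmod_power2 Im_complex_of_real
          Re_complex_of_real power2_eq_square zero_eq_power2)
    then have "\<mu> * (cnj c * c) = cmod c * c" by (simp add: norm_mult m mult.assoc[symmetric])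
    then show ?thesis using c_nz
      by (simp add: mult.commute[of "cnj c"] complex_norm_square[symmetric] u_def field_simps power2_eq_square)
  qed
  \<comment> \<open>The complement of this eigenspace is invariant because \<open>A\<close>
    preserves inner products. A compression eigenvector there is a true eigenvector, whose
    eigenvalue must be \<open>u\<close>; so the complement is zero.\<close>
  define F where "F = {x. A x = u *\<^sub>C x}"
  have F: "complex_vector.subspace F"
    by (simp add: complex_vector.subspace_def F_def A_add A_scale scaleC_add_right
        complex_vector.scale_left_commute)
  have "g = 0" if g: "g \<in> orthogonal_complement F" for g
  proof (rule ccontr)
    assume "g \<noteq> 0"
    from compression_eigenvector[OF orthogonal_complement_subspace g this]
    obtain e where e: "e \<in> orthogonal_complement F" "cinner e e = 1"
      "\<And>y. y \<in> orthogonal_complement F \<Longrightarrow> cinner e y = 0 \<Longrightarrow> cinner (A e) y = 0" by blast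
    have "cinner (A e) f = 0" if "f \<in> F" for f
    proof -
      have "cnj u * cinner (A e) f = cinner (A e) (A f)" using that by (simp add: F_def cinner_simps)
      also have "\<dots> = 0" using that e(1) by (simp add: iso' orthogonal_complement_def)
      finally show ?thesis using u by auto
    qed
    then have "A e \<in> orthogonal_complement F" by (simp add: orthogonal_complement_def)
    define z where "z = A e - cinner (A e) e *\<^sub>C e"
    have z: "z \<in> orthogonal_complement F" unfolding z_def
      using \<open>A e \<in> _\<close> e(1) orthogonal_complement_subspace
      by (intro complex_vector.subspace_diff complex_vector.subspace_scale) auto
    have "cinner z e = 0" by (simp add: z_def cinner_simps e)
    then have ez: "cinner e z = 0" using cinner_eq_0_commute by blast
    have "cinner z z = cinner (A e) z - cinner (A e) e * cinner e z"
      by (simp add: z_def cinner_diff_left cinner_scaleC_left)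
    also have "\<dots> = 0" using e(3)[OF z ez] ez by simp
    finally have "z = 0" by (simp add: cinner_eq_zero_iff)
    then have Ae: "A e = cinner (A e) e *\<^sub>C e" by (simp add: z_def)
    with eig[OF e(2) Ae] have "e \<in> F" by (simp add: F_def)
    then show False using e by (simp add: orthogonal_complement_def)
  qed
  then have "x \<in> F" for x
    using orthogonal_complement_decomp[OF dim_pos F, of x] by (metis add.right_neutral)
  then have "numerical_range A \<subseteq> {u}"
    by (auto simp: numerical_range_def F_def cinner_simps cinner_self)
  moreover have "c \<in> cball c r" "c + r \<in> cball c r" using r_pos by (simp_all add: dist_norm)
  ultimately have "c = u" "c + r = u" using disk by blast+
  then show False using r_pos by simp
qed

end

lemma ex_unimodular: "\<exists>w. cmod w = 1 \<and> z * w = of_real (cmod z)"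
proof (cases "z = 0")
  case False
  then show ?thesis
    by (intro exI[of _ "cnj z / of_real (cmod z)"])
      (simp add: norm_divide complex_norm_square[symmetric] power2_eq_square)
qed (auto intro: exI[of _ 1])

section \<open>Bounds on the superdiagonal from the numerical range\<close>

context circular_partial_isometry
begin

text \<open>Column \<open>j\<close> belongs to the image of \<open>e j\<close>. Four indices
  suffice, since a nontrivial kernel leaves \<open>E\<close> dimension at most four.\<close>

definition compression :: "(4 \<Rightarrow> 'a) \<Rightarrow> complex^4^4" where
  "compression e = (\<chi> i j. cinner (A (e j)) (e i))"

text \<open>Turns \<open>numerical_bound\<close> into inequalities between matrix entries once
  \<open>\<xi>\<close> is chosen.\<close>

lemma bilinear_bound:
  fixes e :: "4 \<Rightarrow> 'a" and \<xi> :: "4 \<Rightarrow> complex"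
  assumes on: "\<And>i j. cinner (e i) (e j) = (if i = j then 1 else 0)"
  shows "cmod ((\<Sum>i\<in>UNIV. \<Sum>j\<in>UNIV. compression e$i$j * \<xi> j * cnj (\<xi> i))
    - c * (\<Sum>i\<in>UNIV. \<xi> i * cnj (\<xi> i))) \<le> r * (\<Sum>i\<in>UNIV. (cmod (\<xi> i))\<^sup>2)"
proof -
  define x where "x = (\<Sum>i\<in>UNIV. \<xi> i *\<^sub>C e i)"
  have "cinner x x = (\<Sum>j\<in>UNIV. \<Sum>i\<in>UNIV. \<xi> i * cnj (\<xi> j) * cinner (e i) (e j))"
    unfolding x_def by (simp add: cinner_sum_left cinner_sum_right cinner_simps sum_distrib_left mult_ac)
  also have "\<dots> = (\<Sum>i\<in>UNIV. \<xi> i * cnj (\<xi> i))" by (simp add: on if_distrib sum.delta cong: if_cong)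
  finally have xx: "cinner x x = (\<Sum>i\<in>UNIV. \<xi> i * cnj (\<xi> i))" .
  have "complex_of_real ((norm x)\<^sup>2) = of_real (\<Sum>i\<in>UNIV. (cmod (\<xi> i))\<^sup>2)"
    unfolding cinner_self[symmetric] xx of_real_sum by (simp only: complex_norm_square)
  then have nx: "(norm x)\<^sup>2 = (\<Sum>i\<in>UNIV. (cmod (\<xi> i))\<^sup>2)" by (simp only: of_real_eq_iff)
  have "cinner (A x) x = (\<Sum>i\<in>UNIV. \<Sum>j\<in>UNIV. compression e$i$j * \<xi> j * cnj (\<xi> i))"
    unfolding x_def compression_def
    by (simp add: A_sum A_scale cinner_sum_left cinner_sum_right cinner_simps sum_distrib_left mult_ac)
  then show ?thesis using numerical_bound[of x] unfolding xx nx by simp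
qed

text \<open>Both bounds come from test vectors: \<open>e 3 + e 4\<close>, and \<open>e 1 \<plusminus> sqrt 2 v e 2 + w e 3\<close> with phases
  \<open>v\<close>, \<open>w\<close> aligning the two superdiagonal terms; of the two signs one does not lose to the corner
  entry.\<close>

lemma superdiagonal_bounds:
  fixes e :: "4 \<Rightarrow> 'a"
  defines "C \<equiv> compression e"
  assumes on: "\<And>i j. cinner (e i) (e j) = (if i = j then 1 else 0)"
    and tri: "C$2$1 = 0" "C$3$1 = 0" "C$3$2 = 0" "C$4$3 = 0"
    and diag: "\<And>i. C$i$i = c"
  shows "cmod (C$3$4) \<le> 2 * r" "sqrt 2 * (cmod (C$1$2) + cmod (C$2$3)) \<le> 4 * r"
proof -
  note b = bilinear_bound[OF on, folded C_def, unfolded sum_4]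
  from b[of "(\<lambda>_. 0)(3 := 1, 4 := 1)"] show "cmod (C$3$4) \<le> 2 * r"
    by (simp add: tri diag algebra_simps)
  obtain v where v: "cmod v = 1" "C$1$2 * v = of_real (cmod (C$1$2))"
    using ex_unimodular by blast
  obtain w where w: "cmod w = 1" "C$2$3 * cnj v * w = of_real (cmod (C$2$3 * cnj v))"
    using ex_unimodular by blast
  \<comment> \<open>The weights 1, \<open>sqrt 2\<close>, 1 are the leading eigenvector of the path
    on three vertices, the best choice for two superdiagonal entries of equal modulus. The squared
    norm of the test vector is 4.\<close>
  define S where "S = sqrt 2 * (cmod (C$1$2) + cmod (C$2$3))"
  have vv: "v * cnj v = 1" "w * cnj w = 1" using v w by (simp_all add: complex_norm_square[symmetric])
  have s2: "complex_of_real (sqrt 2) * of_real (sqrt 2) = 2"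
    by (simp flip: of_real_mult)
  have *: "cmod (k * of_real S + C$1$3 * w) \<le> 4 * r" if k: "k = 1 \<or> k = - 1" for k
  proof -
    have h1: "C$1$2 * (k * sqrt 2 * v) = k * sqrt 2 * cmod (C$1$2)"
      using v by (simp add: mult_ac)
    have h2: "C$2$3 * w * cnj (k * sqrt 2 * v) = k * sqrt 2 * cmod (C$2$3)"
    proof -
      have "C$2$3 * w * cnj (k * sqrt 2 * v) = k * sqrt 2 * (C$2$3 * cnj v * w)" using k by auto
      then show ?thesis unfolding w by (simp add: norm_mult v)
    qed
    have "C$1$2 * (k * sqrt 2 * v) + C$2$3 * w * cnj (k * sqrt 2 * v) = k * of_real S"
      unfolding h1 h2 by (simp add: S_def algebra_simps)
    moreover have "(k * sqrt 2 * v) * cnj (k * sqrt 2 * v) = 2"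
    proof -
      have "(k * sqrt 2 * v) * cnj (k * sqrt 2 * v) = (of_real (sqrt 2) * of_real (sqrt 2)) * (v * cnj v)"
        using k by auto
      then show ?thesis unfolding s2 vv by simp
    qed
    moreover have "cmod (k * sqrt 2 * v) = sqrt 2" using k v by (auto simp: norm_mult)
    ultimately show ?thesis
      using b[of "(\<lambda>_. 0)(1 := 1, 2 := k * sqrt 2 * v, 3 := w)"] vv(2) w(1)
      by (simp add: tri diag algebra_simps)
  qed
  \<comment> \<open>Subtracting the estimates for the two signs cancels the corner entry
    \<open>C$1$3\<close>.\<close>
  have "2 * S \<le> cmod (2 * of_real S)" by (simp add: norm_mult)
  also have "\<dots> = cmod ((1 * of_real S + C$1$3 * w) - (- 1 * of_real S + C$1$3 * w))" by simp
  also have "\<dots> \<le> 4 * r + 4 * r"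
    using norm_triangle_ineq4 *[of 1] *[of "- 1"] by (smt (verit))
  finally show "sqrt 2 * (cmod (C$1$2) + cmod (C$2$3)) \<le> 4 * r" unfolding S_def by simp
qed

end

section \<open>Triangular form of the compression and singularity of its pencil\<close>

context circular_partial_isometry
begin

text \<open>Allowing \<open>e = 0\<close> when \<open>S = {0}\<close> lets the construction run
  exactly four times whatever the dimension of \<open>E\<close>.\<close>

lemma compression_step:
  assumes S: "complex_vector.subspace S"
  obtains e where "e \<in> S" "e = 0 \<and> S = {0} \<or> cinner e e = 1"
    "\<And>y. y \<in> S \<Longrightarrow> cinner e y = 0 \<Longrightarrow> cinner (A e) y = 0"
proof (cases "S = {0}")
  case False
  then obtain v where "v \<in> S" "v \<noteq> 0" using S complex_vector.subspace_0 by blast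
  from compression_eigenvector[OF S this] show ?thesis using that by metis
qed (use that[of 0] in auto)

text \<open>If \<open>E\<close> has dimension less than four, the basis is padded with zero vectors.\<close>

lemma triangular_basis:
  assumes dim: "complex_vector.dim (UNIV :: 'a set) = 5"
  obtains e :: "4 \<Rightarrow> 'a" where "\<And>i. e i \<in> E" "\<And>i. e i = 0 \<or> cinner (e i) (e i) = 1"
    "\<And>i j. i \<noteq> j \<Longrightarrow> cinner (e i) (e j) = 0"
    "\<And>x. x \<in> E \<Longrightarrow> x = (\<Sum>i\<in>UNIV. cinner x (e i) *\<^sub>C e i)"
    "compression e$2$1 = 0" "compression e$3$1 = 0" "compression e$4$1 = 0"
    "compression e$3$2 = 0" "compression e$4$2 = 0" "compression e$4$3 = 0"
proof -
  have sub: "complex_vector.subspace (S \<inter> {y. cinner v y = 0})"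
    if "complex_vector.subspace S" for S and v :: 'a
    using that by (auto simp: complex_vector.subspace_def cinner_simps)
  \<comment> \<open>Schur triangularisation: \<open>S2\<close> to \<open>S5\<close> arise by
    successively removing compression eigenvectors. \<open>A e1\<close> is orthogonal to
    \<open>S2\<close>, and so on, which gives the zeros below the diagonal.\<close>
  define S1 where "S1 = E"
  have S1: "complex_vector.subspace S1" unfolding S1_def by (rule orthogonal_complement_subspace)
  obtain e1 where e1: "e1 \<in> S1" "e1 = 0 \<and> S1 = {0} \<or> cinner e1 e1 = 1"
    "\<And>y. y \<in> S1 \<Longrightarrow> cinner e1 y = 0 \<Longrightarrow> cinner (A e1) y = 0"
    using compression_step[OF S1] by metis
  define S2 where "S2 = S1 \<inter> {y. cinner e1 y = 0}"
  have S2: "complex_vector.subspace S2" unfolding S2_def by (rule sub[OF S1])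
  obtain e2 where e2: "e2 \<in> S2" "e2 = 0 \<and> S2 = {0} \<or> cinner e2 e2 = 1"
    "\<And>y. y \<in> S2 \<Longrightarrow> cinner e2 y = 0 \<Longrightarrow> cinner (A e2) y = 0"
    using compression_step[OF S2] by metis
  define S3 where "S3 = S2 \<inter> {y. cinner e2 y = 0}"
  have S3: "complex_vector.subspace S3" unfolding S3_def by (rule sub[OF S2])
  obtain e3 where e3: "e3 \<in> S3" "e3 = 0 \<and> S3 = {0} \<or> cinner e3 e3 = 1"
    "\<And>y. y \<in> S3 \<Longrightarrow> cinner e3 y = 0 \<Longrightarrow> cinner (A e3) y = 0"
    using compression_step[OF S3] by metis
  define S4 where "S4 = S3 \<inter> {y. cinner e3 y = 0}"
  have S4: "complex_vector.subspace S4" unfolding S4_def by (rule sub[OF S3])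
  obtain e4 where e4: "e4 \<in> S4" "e4 = 0 \<and> S4 = {0} \<or> cinner e4 e4 = 1"
    "\<And>y. y \<in> S4 \<Longrightarrow> cinner e4 y = 0 \<Longrightarrow> cinner (A e4) y = 0"
    using compression_step[OF S4] by metis
  define S5 where "S5 = S4 \<inter> {y. cinner e4 y = 0}"
  have S5: "complex_vector.subspace S5" unfolding S5_def by (rule sub[OF S4])
  have mem: "e2 \<in> S1" "e3 \<in> S1" "e4 \<in> S1" "e3 \<in> S2" "e4 \<in> S2" "e4 \<in> S3"
    and o: "cinner e1 e2 = 0" "cinner e1 e3 = 0" "cinner e1 e4 = 0" "cinner e2 e3 = 0"
      "cinner e2 e4 = 0" "cinner e3 e4 = 0"
    using e1(1) e2(1) e3(1) e4(1) by (auto simp: S2_def S3_def S4_def)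
  note o' = o[THEN cinner_eq_0_commute[THEN iffD1]]
  \<comment> \<open>A nonzero vector here would rule out padding at every stage; together with
    \<open>e1\<close> to \<open>e4\<close> and a unit kernel vector it would give six orthonormal
    vectors in dimension five.\<close>
  have S5_0: "y = 0" if "y \<in> S5" for y
  proof (rule ccontr)
    assume "y \<noteq> 0"
    then obtain k where k: "cinner (k *\<^sub>C y) (k *\<^sub>C y) = 1" by (rule ex_unit_multiple)
    define z where "z = k *\<^sub>C y"
    have z: "z \<in> S5" unfolding z_def using S5 that by (rule complex_vector.subspace_scale)
    have zz: "cinner z z = 1" "z \<noteq> 0" using k unfolding z_def by auto
    have zS: "z \<in> S1" "z \<in> S2" "z \<in> S3" "z \<in> S4"
      and zo: "cinner e1 z = 0" "cinner e2 z = 0" "cinner e3 z = 0" "cinner e4 z = 0"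
      using z by (auto simp: S2_def S3_def S4_def S5_def)
    note zo' = zo[THEN cinner_eq_0_commute[THEN iffD1]]
    have n: "cinner e1 e1 = 1" "cinner e2 e2 = 1" "cinner e3 e3 = 1" "cinner e4 e4 = 1"
      using e1(2) e2(2) e3(2) e4(2) zS zz(2) by auto
    obtain q where q: "cinner q q = 1" "A q = 0" using kernel_nontrivial by blast
    have qE: "cinner q v = 0" if "v \<in> S1" for v using that E_kernel(2) q(2) S1_def by blast
    note q0 = qE[OF e1(1)] qE[OF mem(1)] qE[OF mem(2)] qE[OF mem(3)] qE[OF zS(1)]
    have "orthonormal {}" by (simp add: orthonormal_def)
    note a1 = orthonormal_insert[OF this n(1)]
    note a2 = orthonormal_insert[OF a1(1) n(2)]
    note a3 = orthonormal_insert[OF a2(1) n(3)]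
    note a4 = orthonormal_insert[OF a3(1) n(4)]
    note a5 = orthonormal_insert[OF a4(1) zz(1)]
    note a6 = orthonormal_insert[OF a5(1) q(1)]
    have "orthonormal {q, z, e4, e3, e2, e1}" using a6(1) by (simp add: o' zo' q0)
    moreover have "card {q, z, e4, e3, e2, e1} = 6"
      using a1(2) a2(2) a3(2) a4(2) a5(2) a6(2) by (simp add: o' zo' q0)
    ultimately show False using orthonormal_bound(2)[OF dim_pos] dim by fastforce
  qed
  define e :: "4 \<Rightarrow> 'a" where "e i = (if i = 1 then e1 else if i = 2 then e2 else if i = 3 then e3 else e4)" for i
  have ei: "e 1 = e1" "e 2 = e2" "e 3 = e3" "e 4 = e4" by (simp_all add: e_def)
  have eE: "e i \<in> E" for i
    using e1(1) mem(1-3) unfolding e_def S1_def[symmetric] by auto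
  have unit: "e i = 0 \<or> cinner (e i) (e i) = 1" for i
    using e1(2) e2(2) e3(2) e4(2) unfolding e_def by auto
  have "\<forall>i j. i \<noteq> j \<longrightarrow> cinner (e i) (e j) = 0"
    unfolding forall_4 ei using o o' by simp
  then have orth: "cinner (e i) (e j) = 0" if "i \<noteq> j" for i j using that by blast
  have expand: "x = (\<Sum>i\<in>UNIV. cinner x (e i) *\<^sub>C e i)" if x: "x \<in> E" for x
  proof -
    define y where "y = x - (\<Sum>i\<in>UNIV. cinner x (e i) *\<^sub>C e i)"
    have yE: "y \<in> E" unfolding y_def using x eE orthogonal_complement_subspace
      by (intro complex_vector.subspace_diff complex_vector.subspace_sum complex_vector.subspace_scale)
    have "cinner y (e j) = 0" for j
    proof -
      have "cinner (\<Sum>i\<in>UNIV. cinner x (e i) *\<^sub>C e i) (e j)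
          = (\<Sum>i\<in>UNIV. if i = j then cinner x (e j) * cinner (e j) (e j) else 0)"
        unfolding cinner_sum_left cinner_scaleC_left by (intro sum.cong) (auto simp: orth)
      also have "\<dots> = cinner x (e j) * cinner (e j) (e j)" by simp
      also have "\<dots> = cinner x (e j)" using unit[of j] by auto
      finally show ?thesis by (simp add: y_def cinner_diff_left)
    qed
    then have "cinner (e j) y = 0" for j using cinner_eq_0_commute by blast
    from this[of 1] this[of 2] this[of 3] this[of 4] have "y \<in> S5"
      using yE unfolding ei S5_def S4_def S3_def S2_def S1_def by simp
    from S5_0[OF this] show ?thesis by (simp add: y_def)
  qed
  show ?thesis
    by (rule that[OF eE unit orth expand])
      (simp_all add: compression_def ei e1(3) e2(3) e3(3) mem o)
qed

text \<open>Split the extremal vector into a kernel part \<open>x0\<close> and a part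
  \<open>x1\<close> in \<open>E\<close>. Testing with kernel vectors expresses
  \<open>w *\<^sub>C x0\<close> through \<open>A x1\<close>; testing with \<open>e j\<close> and
  multiplying by \<open>w\<close> then eliminates \<open>x0\<close>, and the coordinates of
  \<open>x1\<close> form a null vector of the pencil.\<close>

lemma singular_pencil:
  fixes e :: "4 \<Rightarrow> 'a" and t :: complex
  assumes eE: "\<And>i. e i \<in> E"
    and expand: "\<And>x. x \<in> E \<Longrightarrow> x = (\<Sum>i\<in>UNIV. cinner x (e i) *\<^sub>C e i)"
    and t: "cmod t = 1" and w: "2 * complex_of_real r * t - c*t\<^sup>2 - cnj c \<noteq> 0"
  shows "det (pencil (2 * complex_of_real r * t - c*t\<^sup>2 - cnj c) (compression e) t) = 0"
proof -
  define w where "w = 2 * complex_of_real r * t - c*t\<^sup>2 - cnj c"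
  define C where "C = compression e"
  obtain x where x: "x \<noteq> 0"
    "\<And>y. t\<^sup>2 * cinner (A x) y + cinner x (A y) + w * cinner x y = 0"
    using extremal_vector[OF t] unfolding w_def by metis
  obtain x0 x1 where d: "A x0 = 0" "x1 \<in> E" "x = x0 + x1" by (rule kernel_decomp)
  have Ax: "A x = A x1" by (simp add: d A_add)
  define \<xi> where "\<xi> = (\<chi> i. cinner x1 (e i))"
  have x1: "x1 = (\<Sum>i\<in>UNIV. \<xi>$i *\<^sub>C e i)" unfolding \<xi>_def using expand[OF d(2)] by simp
  have ker: "w * cinner x0 y = - (t\<^sup>2 * cinner (A x1) y)" if "A y = 0" for y
    using x(2)[of y, unfolded Ax] that E_kernel(1)[OF d(2) that]
    by (simp add: d(3) cinner_add_left eq_neg_iff_add_eq_0 add.commute)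
  have "\<xi> \<noteq> 0"
  proof
    assume "\<xi> = 0"
    then have "x1 = 0" using x1 by simp
    then have "x0 = 0" using ker[OF d(1)] w unfolding w_def[symmetric]
      by (simp add: cinner_eq_zero_iff)
    with \<open>x1 = 0\<close> d x show False by simp
  qed
  have Ax1: "cinner (A x1) (e i) = (\<Sum>l\<in>UNIV. C$i$l * \<xi>$l)" for i
    by (subst x1) (simp add: A_sum A_scale cinner_sum_left cinner_scaleC_left C_def
        compression_def mult.commute)
  have "(pencil w C t *v \<xi>)$j = 0" for j
  proof -
    obtain K V where KV: "A K = 0" "V \<in> E" "A (e j) = K + V" by (rule kernel_decomp)
    have "cinner V (e i) = C$i$j" for i
      using E_kernel(2)[OF eE KV(1)] by (simp add: C_def compression_def KV cinner_add_left)
    then have V: "V = (\<Sum>i\<in>UNIV. C$i$j *\<^sub>C e i)" using expand[OF KV(2)] by simp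
    have x1V: "cinner x1 V = (\<Sum>i\<in>UNIV. \<xi>$i * cnj (C$i$j))"
      unfolding V by (simp add: cinner_sum_right cinner_scaleC_right \<xi>_def mult.commute)
    have AxV: "cinner (A x1) V = (\<Sum>i\<in>UNIV. (\<Sum>l\<in>UNIV. C$i$l * \<xi>$l) * cnj (C$i$j))"
      unfolding V by (simp add: cinner_sum_right cinner_scaleC_right Ax1 mult.commute)
    \<comment> \<open>The kernel component of \<open>A x1\<close> is not visible in
      \<open>C\<close>; the isometry property recovers its pairing with \<open>K\<close>, producing
      the terms \<open>- t\<^sup>2\<close> and \<open>t\<^sup>2 C\<^sup>* C\<close> of the
      pencil.\<close>
    have "cinner (A x1) K = cinner (A x1) (A (e j)) - cinner (A x1) V"
      by (simp add: KV cinner_add_right)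
    also have "cinner (A x1) (A (e j)) = \<xi>$j" using cinner_iso[OF d(2) eE] by (simp add: \<xi>_def)
    finally have x0K: "w * cinner x0 K = - (t\<^sup>2 * (\<xi>$j - cinner (A x1) V))" using ker[OF KV(1)] by simp
    have "cinner x (A (e j)) = cinner x0 K + cinner x1 V"
      using E_kernel(1)[OF d(2) KV(1)] E_kernel(2)[OF KV(2) d(1)] by (simp add: d KV cinner_simps)
    then have "t\<^sup>2 * (\<Sum>l\<in>UNIV. C$j$l * \<xi>$l) + (cinner x0 K + cinner x1 V) + w * \<xi>$j = 0"
      using x(2)[of "e j", unfolded Ax] E_kernel(2)[OF eE d(1)]
      by (simp add: Ax1 d(3) cinner_add_left \<xi>_def)
    then have "w * (t\<^sup>2 * (\<Sum>l\<in>UNIV. C$j$l * \<xi>$l) + (cinner x0 K + cinner x1 V) + w * \<xi>$j) = 0" by simp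
    then have *: "w * t\<^sup>2 * (\<Sum>l\<in>UNIV. C$j$l * \<xi>$l) + w * cinner x1 V + (w\<^sup>2 - t\<^sup>2) * \<xi>$j
        + t\<^sup>2 * cinner (A x1) V = 0"
      using x0K by algebra
    have entry: "pencil w C t$j$l * \<xi>$l = w * t\<^sup>2 * (C$j$l * \<xi>$l) + w * (\<xi>$l * cnj (C$l$j))
        + (if j = l then (w\<^sup>2 - t\<^sup>2) * \<xi>$l else 0) + t\<^sup>2 * (\<Sum>i\<in>UNIV. C$i$l * \<xi>$l * cnj (C$i$j))" for l
    proof -
      have "(\<Sum>i\<in>UNIV. C$i$l * \<xi>$l * cnj (C$i$j)) = (\<Sum>i\<in>UNIV. C$i$l * cnj (C$i$j)) * \<xi>$l"
        by (simp add: sum_distrib_right sum_distrib_left mult_ac)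
      then show ?thesis by (simp add: pencil_def algebra_simps)
    qed
    have "(pencil w C t *v \<xi>)$j = w * t\<^sup>2 * (\<Sum>l\<in>UNIV. C$j$l * \<xi>$l)
        + w * (\<Sum>i\<in>UNIV. \<xi>$i * cnj (C$i$j)) + (\<Sum>l\<in>UNIV. if j = l then (w\<^sup>2 - t\<^sup>2) * \<xi>$l else 0)
        + t\<^sup>2 * (\<Sum>l\<in>UNIV. \<Sum>i\<in>UNIV. C$i$l * \<xi>$l * cnj (C$i$j))"
      unfolding matrix_vector_mult_def
      by (simp add: entry sum.distrib sum_distrib_left)
    also have "(\<Sum>l\<in>UNIV. \<Sum>i\<in>UNIV. C$i$l * \<xi>$l * cnj (C$i$j)) = cinner (A x1) V"
      unfolding AxV sum_distrib_right by (rule sum.swap)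
    finally show ?thesis using * by (simp add: x1V)
  qed
  then have "pencil w C t *v \<xi> = 0" by (simp add: vec_eq_iff)
  with \<open>\<xi> \<noteq> 0\<close> show ?thesis unfolding w_def[symmetric] C_def[symmetric]
    using invertible_det_nz matrix_left_invertible_ker invertible_def by metis
qed

end

section \<open>The contradiction\<close>

text \<open>The rank-one defect forces \<open>C$1$2\<close> and \<open>C$2$3\<close> to have modulus
  \<open>cmod D\<close>, and the corner equation becomes \<open>16 r^4 = D^2 |C$3$4|^2\<close>. The
  bounds give \<open>D^2 \<le> 2 r^2\<close> and \<open>|C$3$4|^2 \<le> 4 r^2\<close>, a product of
  only \<open>8 r^4\<close>.\<close>

lemma nilpotent_defect_contradiction:
  fixes b :: "4 \<Rightarrow> complex" and C :: "complex^4^4" and r :: real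
  assumes tri: "C$2$1 = 0" "C$3$1 = 0" "C$4$1 = 0" "C$3$2 = 0" "C$4$2 = 0" "C$4$3 = 0"
    and diag: "\<And>i. C$i$i = c"
    and iso: "\<And>i j. b i * cnj (b j) + (\<Sum>k\<in>UNIV. C$k$i * cnj (C$k$j)) = (if i = j then 1 else 0)"
    and corner: "16 * complex_of_real r^4 * (cnj c)\<^sup>2 = C$1$4 * cnj (C$1$2 * C$2$3 * C$3$4)"
    and "c \<noteq> 0" "r > 0"
    and bnd: "cmod (C$3$4) \<le> 2 * r" "sqrt 2 * (cmod (C$1$2) + cmod (C$2$3)) \<le> 4 * r"
  shows False
proof -
  define D where "D = b 1 * cnj (b 1)"
  note iso' = iso[unfolded sum_4]
  have e: "D + c * cnj c = 1"
    "b 2 * cnj (b 1) + C$1$2 * cnj c = 0"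
    "b 3 * cnj (b 1) + C$1$3 * cnj c = 0"
    "b 4 * cnj (b 1) + C$1$4 * cnj c = 0"
    "b 2 * cnj (b 2) + C$1$2 * cnj (C$1$2) + c * cnj c = 1"
    "b 3 * cnj (b 2) + C$1$3 * cnj (C$1$2) + C$2$3 * cnj c = 0"
    "b 4 * cnj (b 2) + C$1$4 * cnj (C$1$2) + C$2$4 * cnj c = 0"
    "b 3 * cnj (b 3) + C$1$3 * cnj (C$1$3) + C$2$3 * cnj (C$2$3) + c * cnj c = 1"
    "b 4 * cnj (b 3) + C$1$4 * cnj (C$1$3) + C$2$4 * cnj (C$2$3) + C$3$4 * cnj c = 0"
    using iso'[of 1 1] iso'[of 2 1] iso'[of 3 1] iso'[of 4 1] iso'[of 2 2] iso'[of 3 2]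
      iso'[of 4 2] iso'[of 3 3] iso'[of 4 3] by (simp_all add: tri diag D_def add.assoc)
  have ec: "cnj (b 2) * b 1 + cnj (C$1$2) * c = 0" "cnj (b 3) * b 1 + cnj (C$1$3) * c = 0"
    using e(2,3)[THEN arg_cong[where f = cnj]] by simp_all
  \<comment> \<open>Multiplying an isometry relation by \<open>D\<close> turns
    \<open>b i * cnj (b j)\<close> into a product of two first-column relations; this removes
    \<open>b\<close> from the system.\<close>
  have f22: "C$1$2 * cnj (C$1$2) = D * D" using e(1,2,5) ec(1) unfolding D_def by algebra
  have f32: "C$1$3 * cnj (C$1$2) + D * (C$2$3 * cnj c) = 0"
    using e(1,3,6) ec(1) unfolding D_def by algebra
  have f42: "C$1$4 * cnj (C$1$2) + D * (C$2$4 * cnj c) = 0"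
    using e(1,4,7) ec(1) unfolding D_def by algebra
  have f33: "C$1$3 * cnj (C$1$3) + D * (C$2$3 * cnj (C$2$3)) = D * D"
    using e(1,3,8) ec(2) unfolding D_def by algebra
  have f43: "C$1$4 * cnj (C$1$3) + D * (C$2$4 * cnj (C$2$3) + C$3$4 * cnj c) = 0"
    using e(1,4,9) ec(2) unfolding D_def by algebra
  have cD: "cnj D = D" by (simp add: D_def)
  have f32c: "cnj (C$1$3) * C$1$2 + D * (cnj (C$2$3) * c) = 0"
    using f32[THEN arg_cong[where f = cnj]] by (simp add: cD)
  have D0: "D \<noteq> 0"
  proof
    assume "D = 0"
    then have "C$1$2 = 0" using f22 by simp
    then show False using corner \<open>c \<noteq> 0\<close> \<open>r > 0\<close> by simp
  qed
  have cmod_eqI: "cmod z = cmod D" if "z * cnj z = D * D" for z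
  proof -
    have "(cmod z)\<^sup>2 = (cmod D)\<^sup>2"
      using arg_cong[OF that, of cmod] by (simp add: norm_mult power2_eq_square)
    then show ?thesis by simp
  qed
  have n12: "cmod (C$1$2) = cmod D" using f22 by (rule cmod_eqI)
  \<comment> \<open>Multiply \<open>f32\<close> by its conjugate and insert
    \<open>f22\<close>.\<close>
  have "D * D * (C$1$3 * cnj (C$1$3) - c * cnj c * (C$2$3 * cnj (C$2$3))) = 0"
    using f32 f32c f22 by algebra
  then have "C$1$3 * cnj (C$1$3) = c * cnj c * (C$2$3 * cnj (C$2$3))" using D0 by simp
  then have "C$2$3 * cnj (C$2$3) = D * D" using f33 e(1) by algebra
  then have n23: "cmod (C$2$3) = cmod D" by (rule cmod_eqI)
  \<comment> \<open>Multiplying \<open>f42\<close> by \<open>cnj (C$2$3)\<close> leaves this product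
    as the only unknown in the corner term; \<open>f43\<close> determines it, so no phases have to
    be chosen.\<close>
  define X where "X = C$2$4 * cnj (C$2$3)"
  have "D * D * (C$1$4 * cnj (C$1$3) - c * cnj c * X) = 0"
    using f42 f32c f22 unfolding X_def by algebra
  then have "C$1$4 * cnj (C$1$3) = c * cnj c * X" using D0 by simp
  then have X: "X = - D * C$3$4 * cnj c" using f43 e(1) unfolding X_def by algebra
  have "C$1$4 * cnj (C$1$2) * cnj (C$2$3) = D * D * C$3$4 * (cnj c)\<^sup>2"
    using f42 X unfolding X_def by algebra
  then have "16 * complex_of_real r^4 * (cnj c)\<^sup>2 = D * D * C$3$4 * cnj (C$3$4) * (cnj c)\<^sup>2"
    unfolding corner by (simp add: mult_ac)
  then have "16 * complex_of_real r^4 = D * D * (C$3$4 * cnj (C$3$4))" using \<open>c \<noteq> 0\<close> by simp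
  from arg_cong[OF this, of cmod]
  have eq: "16 * r^4 = (cmod D * cmod D) * (cmod (C$3$4) * cmod (C$3$4))"
    using \<open>r > 0\<close> by (simp add: norm_mult norm_power)
  have "sqrt 2 * cmod D \<le> 2 * r" using bnd(2) unfolding n12 n23 by (simp add: mult.commute)
  then have "(sqrt 2 * cmod D)\<^sup>2 \<le> (2 * r)\<^sup>2" by (rule power_mono) simp
  then have "(cmod D)\<^sup>2 \<le> 2 * r\<^sup>2" by (simp add: power_mult_distrib)
  then have "cmod D * cmod D \<le> 2 * r\<^sup>2" by (simp add: power2_eq_square)
  moreover have "cmod (C$3$4) * cmod (C$3$4) \<le> (2 * r) * (2 * r)"
    using bnd(1) \<open>r > 0\<close> by (intro mult_mono) auto
  ultimately have "16 * r^4 \<le> (2 * r\<^sup>2) * ((2 * r) * (2 * r))"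
    unfolding eq by (rule mult_mono) simp_all
  also have "\<dots> = 8 * r^4" by (simp add: power4_eq_xxxx power2_eq_square)
  finally show False using \<open>r > 0\<close> by simp
qed

section \<open>Excluding dimension five\<close>

context circular_partial_isometry
begin

lemma dim_ne_5: "complex_vector.dim (UNIV :: 'a set) \<noteq> 5"
proof
  assume dim: "complex_vector.dim (UNIV :: 'a set) = 5"
  obtain e :: "4 \<Rightarrow> 'a" where e: "\<And>i. e i \<in> E" "\<And>i. e i = 0 \<or> cinner (e i) (e i) = 1"
    "\<And>i j. i \<noteq> j \<Longrightarrow> cinner (e i) (e j) = 0"
    "\<And>x. x \<in> E \<Longrightarrow> x = (\<Sum>i\<in>UNIV. cinner x (e i) *\<^sub>C e i)"
    and tri: "compression e$2$1 = 0" "compression e$3$1 = 0" "compression e$4$1 = 0"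
    "compression e$3$2 = 0" "compression e$4$2 = 0" "compression e$4$3 = 0"
    using triangular_basis[OF dim] by blast
  have "complex_of_real r \<noteq> 0" using r_pos by simp
  note tp = triangular_pencil[OF tri this c_nz singular_pencil[of e, OF e(1) e(4)]]
  have diag: "compression e$i$i = c" for i using tp(1) by blast
  have corner: "16 * complex_of_real r^4 * (cnj c)\<^sup>2 =
      compression e$1$4 * cnj (compression e$1$2 * compression e$2$3 * compression e$3$4)"
    using tp(2) by blast
  \<comment> \<open>A padding vector would give a zero diagonal entry, so all four vectors are
    genuine.\<close>
  have e_nz: "e i \<noteq> 0" for i using diag[of i] c_nz by (auto simp: compression_def)
  then have on: "cinner (e i) (e j) = (if i = j then 1 else 0)" for i j using e(2,3) by auto
  have "inj e"
  proof (rule injI)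
    fix i j assume "e i = e j"
    then show "i = j" using on[of i j] on[of j j] by (auto split: if_splits)
  qed
  then have card: "card (range e) = 4" by (simp add: card_image)
  have ran: "orthonormal (range e)" unfolding orthonormal_def using on \<open>inj e\<close> by (auto simp: inj_eq)
  obtain q where q: "cinner q q = 1" "A q = 0" using kernel_nontrivial by blast
  have "\<forall>b\<in>range e. cinner q b = 0" using E_kernel(2)[OF e(1) q(2)] by auto
  note qe = orthonormal_insert[OF ran q(1) this]
  \<comment> \<open>The four \<open>e i\<close> and \<open>q\<close> already exhaust dimension five,
    so the kernel is a line. This makes the defect of \<open>C\<close> have rank one.\<close>
  have ker: "K = cinner K q *\<^sub>C q" if K: "A K = 0" for K
  proof (rule ccontr)
    assume "K \<noteq> cinner K q *\<^sub>C q"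
    then have "K - cinner K q *\<^sub>C q \<noteq> 0" by simp
    then obtain k where k: "cinner (k *\<^sub>C (K - cinner K q *\<^sub>C q)) (k *\<^sub>C (K - cinner K q *\<^sub>C q)) = 1"
      by (rule ex_unit_multiple)
    have "A (k *\<^sub>C (K - cinner K q *\<^sub>C q)) = 0" by (simp add: A_diff A_scale K q)
    then have "\<forall>b\<in>range e. cinner (k *\<^sub>C (K - cinner K q *\<^sub>C q)) b = 0"
      using E_kernel(2)[OF e(1)] by blast
    moreover have "cinner (k *\<^sub>C (K - cinner K q *\<^sub>C q)) q = 0" by (simp add: cinner_simps q)
    ultimately have "\<forall>b\<in>insert q (range e). cinner (k *\<^sub>C (K - cinner K q *\<^sub>C q)) b = 0"
      by blast
    note kq = orthonormal_insert[OF qe(1) k this]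
    then have "card (insert (k *\<^sub>C (K - cinner K q *\<^sub>C q)) (insert q (range e))) = 6"
      using card qe(2) by simp
    then show False using orthonormal_bound(2)[OF dim_pos kq(1)] dim by simp
  qed
  define b where "b j = cinner (A (e j)) q" for j
  have Ae: "A (e j) = b j *\<^sub>C q + (\<Sum>i\<in>UNIV. compression e$i$j *\<^sub>C e i)" for j
  proof -
    obtain K V where KV: "A K = 0" "V \<in> E" "A (e j) = K + V" by (rule kernel_decomp)
    have "cinner V (e i) = compression e$i$j" for i
      using E_kernel(2)[OF e(1) KV(1)] by (simp add: compression_def KV cinner_add_left)
    moreover have "cinner K q = b j"
      using E_kernel(1)[OF KV(2) q(2)] by (simp add: b_def KV cinner_add_left)
    ultimately show ?thesis using KV(3) ker[OF KV(1)] e(4)[OF KV(2)] by simp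
  qed
  have iso_b: "b i * cnj (b j) + (\<Sum>k\<in>UNIV. compression e$k$i * cnj (compression e$k$j))
      = (if i = j then 1 else 0)" for i j
  proof -
    have "(if i = j then 1 else 0) = cinner (A (e i)) (A (e j))"
      by (simp add: cinner_iso e(1) on)
    also have "\<dots> = b i * cnj (b j) + (\<Sum>k\<in>UNIV. compression e$k$i * cnj (compression e$k$j))"
      unfolding Ae[of j] by (simp add: cinner_add_right cinner_sum_right cinner_scaleC_right
          b_def compression_def mult.commute)
    finally show ?thesis by (rule sym)
  qed
  show False
    by (rule nilpotent_defect_contradiction[OF tri diag iso_b corner c_nz r_pos])
      (rule superdiagonal_bounds[OF on tri(1,2,4,6) diag])+
qed

end

theorem theorem1:
  fixes A :: "'a::complex_hilbert_space \<Rightarrow> 'a"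
    and c :: complex and r :: real
  assumes "complex_vector.dim (UNIV :: 'a set) = 5"
    and "partial_isometry A"
    and "r > 0"
    and "numerical_range A = cball c r"
  shows "c = 0"
proof (rule ccontr)
  assume "c \<noteq> 0"
  have lin: "Vector_Spaces.linear scaleC scaleC A"
    using assms(2) by (simp add: partial_isometry_def bounded_clinear_def)
  interpret circular_partial_isometry A c r
  proof
    show "A (x + y) = A x + A y" "A (k *\<^sub>C x) = k *\<^sub>C A x" for x y k
      using lin by (simp_all add: Vector_Spaces.linear_iff)
    show "norm (A x) = norm x" if "x \<in> orthogonal_complement (kernel A)" for x
      using assms(2) that by (simp add: partial_isometry_def)
  qed (use assms \<open>c \<noteq> 0\<close> in auto)
  show False using dim_ne_5 assms(1) by blast
qed

end
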